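(* Let $(M,g)$ be an oriented Riemannian $3$-manifold (not necessarily compact). Then the Cotton tensor of $g$ is trace-free: $\mathrm{tr}_g(\mathfrak{Cott}(g))=0$.
   Context: $\nabla$ is the Levi-Civita connection of $g$, $R_{X,Y}=[\nabla_X,\nabla_Y]-\nabla_{[X,Y]}$ the curvature, $\mathfrak{Ric}(U,V)=\mathrm{tr}[X\mapsto R_{X,U}V]$ the Ricci tensor, $\mathfrak{scal}=\mathrm{tr}_g\mathfrak{Ric}$. The Schouten tensor is $\mathfrak{Sch}:=\mathfrak{Ric}-\frac{\mathfrak{scal}}{4}g$, viewed also as an endomorphism of $TM$ (a $TM$-valued $1$-form) via $g$. The Cotton form is the $TM$-valued $2$-form $\mathfrak{cott}:=d^\nabla\mathfrak{Sch}$, i.e. $(d^\nabla\mathfrak{Sch})(X,Y)=(\nabla_X\mathfrak{Sch})(Y)-(\nabla_Y\mathfrak{Sch})(X)$. The Cotton tensor is the bilinear form $\mathfrak{Cott}(g):=*\,d^\nabla\mathfrak{Sch}$, with the Hodge star $*$ acting on the $2$-form part: for an oriented orthonormal frame $S_1,S_2,S_3$ and $(i,j,k)$ a cyclic permutation of $(1,2,3)$, $*(S^j\wedge S^k)=S^i$, so $\mathfrak{Cott}(S_i,Z)=\langle (d^\nabla\mathfrak{Sch})(S_j,S_k),Z\rangle$. *)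

theory Defs
  imports "HOL-Analysis.Analysis"
begin

section \<open>Smooth maps between open subsets of normed spaces\<close>

primrec Ck_on :: "nat \<Rightarrow> ('a::real_normed_vector \<Rightarrow> 'b::real_normed_vector) \<Rightarrow> 'a set \<Rightarrow> bool" where
  "Ck_on 0 f S \<longleftrightarrow> continuous_on S f"
| "Ck_on (Suc k) f S \<longleftrightarrow>
     (\<forall>x\<in>S. f differentiable (at x)) \<and> (\<forall>v. Ck_on k (\<lambda>x. frechet_derivative f (at x) v) S)"

text \<open>Only used for finite-dimensional domains and open \<open>S\<close>, where directional derivatives of
  all orders give the usual notion of a \<open>C\<^sup>\<infinity>\<close> map.\<close>

definition smooth_on :: "('a::real_normed_vector \<Rightarrow> 'b::real_normed_vector) \<Rightarrow> 'a set \<Rightarrow> bool" where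
  "smooth_on f S \<longleftrightarrow> (\<forall>k. Ck_on k f S)"


section \<open>Charts\<close>

type_synonym 'a chart = "'a set \<times> ('a \<Rightarrow> real^3)"

definition chart_inv :: "'a chart \<Rightarrow> real^3 \<Rightarrow> 'a" where
  "chart_inv c = inv_into (fst c) (snd c)"

definition transition :: "'a chart \<Rightarrow> 'a chart \<Rightarrow> real^3 \<Rightarrow> real^3" where
  "transition c d = snd d \<circ> chart_inv c"

text \<open>The differential at \<open>p\<close> of the coordinate change from \<open>c\<close> to \<open>d\<close>: it turns the
  components of a tangent vector at \<open>p\<close> with respect to \<open>c\<close> into those with respect to \<open>d\<close>.\<close>

definition tangent_change :: "'a chart \<Rightarrow> 'a chart \<Rightarrow> 'a \<Rightarrow> real^3 \<Rightarrow> real^3" where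
  "tangent_change c d p = frechet_derivative (transition c d) (at (snd c p))"


section \<open>Smooth 3-manifolds, tangent vectors, and vector fields\<close>

text \<open>\<open>A\<close> is any smooth atlas; it need not be maximal.\<close>

locale smooth_3manifold =
  fixes M :: "'a topology" and A :: "'a chart set"
  assumes Hausdorff: "Hausdorff_space M"
    and second_countable: "second_countable M"
    and atlas_cover: "topspace M = (\<Union>c\<in>A. fst c)"
    and chart_domain: "c \<in> A \<Longrightarrow> openin M (fst c)"
    and chart_range: "c \<in> A \<Longrightarrow> open (snd c ` fst c)"
    and chart_homeo: "c \<in> A \<Longrightarrow>
          homeomorphic_map (subtopology M (fst c)) (top_of_set (snd c ` fst c)) (snd c)"
    and smooth_transition: "c \<in> A \<Longrightarrow> d \<in> A \<Longrightarrow>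
          smooth_on (transition c d) (snd c ` (fst c \<inter> fst d))"
begin

text \<open>The tangent space at \<open>p\<close> is \<open>real^3\<close>, a vector being represented by its components in
  the chart \<open>chart_at p\<close>, which is chosen once and for all for each point. The components with
  respect to any other chart \<open>c\<close> around \<open>p\<close> are obtained by
  \<open>tangent_change (chart_at p) c p\<close>.

  Functions and vector fields are total HOL functions on \<open>'a\<close>; those defined on an open set
  \<open>W\<close> of \<open>M\<close> are arbitrary outside \<open>W\<close>.\<close>

definition chart_at :: "'a \<Rightarrow> 'a chart" where
  "chart_at p = (SOME c. c \<in> A \<and> p \<in> fst c)"

definition smooth_fun :: "'a set \<Rightarrow> ('a \<Rightarrow> real) \<Rightarrow> bool" where
  "smooth_fun W f \<longleftrightarrow> (\<forall>c\<in>A. smooth_on (f \<circ> chart_inv c) (snd c ` (W \<inter> fst c)))"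

definition field_rep :: "'a chart \<Rightarrow> ('a \<Rightarrow> real^3) \<Rightarrow> real^3 \<Rightarrow> real^3" where
  "field_rep c X x = tangent_change (chart_at (chart_inv c x)) c (chart_inv c x) (X (chart_inv c x))"

definition smooth_field :: "'a set \<Rightarrow> ('a \<Rightarrow> real^3) \<Rightarrow> bool" where
  "smooth_field W X \<longleftrightarrow> (\<forall>c\<in>A. smooth_on (field_rep c X) (snd c ` (W \<inter> fst c)))"

text \<open>The derivative of the function \<open>f\<close> along the tangent vector \<open>v\<close> at \<open>p\<close>.\<close>

definition vec_deriv :: "'a \<Rightarrow> real^3 \<Rightarrow> ('a \<Rightarrow> real) \<Rightarrow> real" where
  "vec_deriv p v f = frechet_derivative (f \<circ> chart_inv (chart_at p)) (at (snd (chart_at p) p)) v"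

definition field_deriv :: "('a \<Rightarrow> real^3) \<Rightarrow> ('a \<Rightarrow> real) \<Rightarrow> 'a \<Rightarrow> real" where
  "field_deriv X f p = vec_deriv p (X p) f"

definition lie_bracket :: "('a \<Rightarrow> real^3) \<Rightarrow> ('a \<Rightarrow> real^3) \<Rightarrow> 'a \<Rightarrow> real^3" where
  "lie_bracket X Y p = (THE v. \<forall>W f. openin M W \<and> p \<in> W \<and> smooth_fun W f \<longrightarrow>
     vec_deriv p v f = field_deriv X (field_deriv Y f) p - field_deriv Y (field_deriv X f) p)"

text \<open>A vector field around \<open>p\<close> with value \<open>v\<close> at \<open>p\<close>, namely the one with constant
  components in \<open>chart_at p\<close>. It serves to evaluate tensorial (that is,
  \<open>C\<^sup>\<infinity>\<close>-multilinear) expressions in vector fields on tangent vectors at \<open>p\<close>; the result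
  does not depend on the extension.\<close>

definition extend :: "'a \<Rightarrow> real^3 \<Rightarrow> 'a \<Rightarrow> real^3" where
  "extend p v q = tangent_change (chart_at p) (chart_at q) q v"

end

locale oriented_3manifold = smooth_3manifold M A
  for M :: "'a topology" and A :: "'a chart set" +
  assumes orientation: "c \<in> A \<Longrightarrow> d \<in> A \<Longrightarrow> p \<in> fst c \<inter> fst d \<Longrightarrow>
    det (matrix (tangent_change c d p)) > 0"


section \<open>Riemannian metrics\<close>

locale oriented_riemannian_3manifold = oriented_3manifold M A
  for M :: "'a topology" and A :: "'a chart set" +
  fixes g :: "'a \<Rightarrow> real^3 \<Rightarrow> real^3 \<Rightarrow> real"
  assumes metric_bilinear: "p \<in> topspace M \<Longrightarrow> bilinear (g p)"
    and metric_sym: "p \<in> topspace M \<Longrightarrow> g p v w = g p w v"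
    and metric_pos: "p \<in> topspace M \<Longrightarrow> v \<noteq> 0 \<Longrightarrow> g p v v > 0"
    and metric_smooth: "openin M W \<Longrightarrow> smooth_field W X \<Longrightarrow> smooth_field W Y \<Longrightarrow>
          smooth_fun W (\<lambda>p. g p (X p) (Y p))"
begin

definition sharp :: "'a \<Rightarrow> (real^3 \<Rightarrow> real) \<Rightarrow> real^3" where
  "sharp p \<alpha> = (THE w. \<forall>v. g p w v = \<alpha> v)"

definition endo_of_form :: "'a \<Rightarrow> (real^3 \<Rightarrow> real^3 \<Rightarrow> real) \<Rightarrow> real^3 \<Rightarrow> real^3" where
  "endo_of_form p B v = sharp p (B v)"

definition metric_trace :: "'a \<Rightarrow> (real^3 \<Rightarrow> real^3 \<Rightarrow> real) \<Rightarrow> real" where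
  "metric_trace p B = trace (matrix (endo_of_form p B))"

text \<open>The three vectors are the rows of \<open>S\<close>. Since the atlas is oriented, a basis of the tangent
  space at \<open>p\<close> is positive if its components in \<open>chart_at p\<close> have positive determinant.\<close>

definition oriented_orthonormal :: "'a \<Rightarrow> real^3^3 \<Rightarrow> bool" where
  "oriented_orthonormal p S \<longleftrightarrow>
     (\<forall>i j. g p (S $ i) (S $ j) = (if i = j then 1 else 0)) \<and> det S > 0"

text \<open>The Hodge star on (vector-valued) 2-forms on the tangent space at \<open>p\<close>.\<close>

definition hodge_star :: "'a \<Rightarrow> (real^3 \<Rightarrow> real^3 \<Rightarrow> real^3) \<Rightarrow> real^3 \<Rightarrow> real^3" where
  "hodge_star p \<omega> = (THE \<alpha>. linear \<alpha> \<and> (\<forall>S. oriented_orthonormal p S \<longrightarrow>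
     \<alpha> (S $ 1) = \<omega> (S $ 2) (S $ 3) \<and>
     \<alpha> (S $ 2) = \<omega> (S $ 3) (S $ 1) \<and>
     \<alpha> (S $ 3) = \<omega> (S $ 1) (S $ 2)))"

end


section \<open>The Levi-Civita connection, curvature, and the Cotton tensor\<close>

text \<open>Connections act on vector fields defined on arbitrary open sets, so that the axioms apply
  to local frames. Locality of \<open>\<nabla>\<close> follows from the Leibniz rule.\<close>

locale levi_civita_3manifold = oriented_riemannian_3manifold M A g
  for M :: "'a topology" and A :: "'a chart set"
    and g :: "'a \<Rightarrow> real^3 \<Rightarrow> real^3 \<Rightarrow> real" +
  fixes nabla :: "('a \<Rightarrow> real^3) \<Rightarrow> ('a \<Rightarrow> real^3) \<Rightarrow> 'a \<Rightarrow> real^3"  ("\<nabla>")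
  assumes nabla_smooth: "openin M W \<Longrightarrow> smooth_field W X \<Longrightarrow> smooth_field W Y \<Longrightarrow>
          smooth_field W (\<nabla> X Y)"
    and nabla_add_left: "openin M W \<Longrightarrow> smooth_field W X \<Longrightarrow> smooth_field W X' \<Longrightarrow>
          smooth_field W Y \<Longrightarrow> p \<in> W \<Longrightarrow>
          \<nabla> (\<lambda>q. X q + X' q) Y p = \<nabla> X Y p + \<nabla> X' Y p"
    and nabla_scale_left: "openin M W \<Longrightarrow> smooth_fun W f \<Longrightarrow> smooth_field W X \<Longrightarrow>
          smooth_field W Y \<Longrightarrow> p \<in> W \<Longrightarrow>
          \<nabla> (\<lambda>q. f q *\<^sub>R X q) Y p = f p *\<^sub>R \<nabla> X Y p"
    and nabla_add_right: "openin M W \<Longrightarrow> smooth_field W X \<Longrightarrow> smooth_field W Y \<Longrightarrow>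
          smooth_field W Y' \<Longrightarrow> p \<in> W \<Longrightarrow>
          \<nabla> X (\<lambda>q. Y q + Y' q) p = \<nabla> X Y p + \<nabla> X Y' p"
    and nabla_Leibniz: "openin M W \<Longrightarrow> smooth_fun W f \<Longrightarrow> smooth_field W X \<Longrightarrow>
          smooth_field W Y \<Longrightarrow> p \<in> W \<Longrightarrow>
          \<nabla> X (\<lambda>q. f q *\<^sub>R Y q) p = field_deriv X f p *\<^sub>R Y p + f p *\<^sub>R \<nabla> X Y p"
    and nabla_torsion_free: "openin M W \<Longrightarrow> smooth_field W X \<Longrightarrow> smooth_field W Y \<Longrightarrow> p \<in> W \<Longrightarrow>
          \<nabla> X Y p - \<nabla> Y X p = lie_bracket X Y p"
    and nabla_metric: "openin M W \<Longrightarrow> smooth_field W X \<Longrightarrow> smooth_field W Y \<Longrightarrow>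
          smooth_field W Z \<Longrightarrow> p \<in> W \<Longrightarrow>
          field_deriv X (\<lambda>q. g q (Y q) (Z q)) p = g p (\<nabla> X Y p) (Z p) + g p (Y p) (\<nabla> X Z p)"
begin

definition curvature_op ::
    "('a \<Rightarrow> real^3) \<Rightarrow> ('a \<Rightarrow> real^3) \<Rightarrow> ('a \<Rightarrow> real^3) \<Rightarrow> 'a \<Rightarrow> real^3" where
  "curvature_op X Y Z p =
     \<nabla> X (\<nabla> Y Z) p - \<nabla> Y (\<nabla> X Z) p - \<nabla> (lie_bracket X Y) Z p"

definition curvature :: "'a \<Rightarrow> real^3 \<Rightarrow> real^3 \<Rightarrow> real^3 \<Rightarrow> real^3" where
  "curvature p x y z = curvature_op (extend p x) (extend p y) (extend p z) p"

definition ricci :: "'a \<Rightarrow> real^3 \<Rightarrow> real^3 \<Rightarrow> real" where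
  "ricci p u v = trace (matrix (\<lambda>x. curvature p x u v))"

definition scal :: "'a \<Rightarrow> real" where
  "scal p = metric_trace p (ricci p)"

definition schouten :: "'a \<Rightarrow> real^3 \<Rightarrow> real^3 \<Rightarrow> real" where
  "schouten p u v = ricci p u v - scal p / 4 * g p u v"

definition schouten_endo :: "'a \<Rightarrow> real^3 \<Rightarrow> real^3" where
  "schouten_endo p = endo_of_form p (schouten p)"

text \<open>\<open>(\<nabla>\<^sub>X Sch)(Y)\<close> for the endomorphism field \<open>Sch\<close>.\<close>

definition nabla_schouten :: "('a \<Rightarrow> real^3) \<Rightarrow> ('a \<Rightarrow> real^3) \<Rightarrow> 'a \<Rightarrow> real^3" where
  "nabla_schouten X Y p =
     \<nabla> X (\<lambda>q. schouten_endo q (Y q)) p - schouten_endo p (\<nabla> X Y p)"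

definition cotton_form_op :: "('a \<Rightarrow> real^3) \<Rightarrow> ('a \<Rightarrow> real^3) \<Rightarrow> 'a \<Rightarrow> real^3" where
  "cotton_form_op X Y p = nabla_schouten X Y p - nabla_schouten Y X p"

definition cotton_form :: "'a \<Rightarrow> real^3 \<Rightarrow> real^3 \<Rightarrow> real^3" where
  "cotton_form p x y = cotton_form_op (extend p x) (extend p y) p"

definition cotton_tensor :: "'a \<Rightarrow> real^3 \<Rightarrow> real^3 \<Rightarrow> real" where
  "cotton_tensor p x z = g p (hodge_star p (cotton_form p) x) z"

end

end

theory Submission
  imports Defs
begin

text \<open>The trace of the Cotton tensor vanishes by symmetry alone. Write \<open>S\<close> for the Schouten endomorphism
  and let \<open>e\<^sub>1, e\<^sub>2, e\<^sub>3\<close> be an oriented orthonormal basis of a tangent space. By the definition of the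
  Hodge star the trace is the cyclic sum of \<open>g ((\<nabla>\<^sub>i S) e\<^sub>j - (\<nabla>\<^sub>j S) e\<^sub>i) e\<^sub>k\<close>. If every \<open>\<nabla>\<^sub>i S\<close> is
  self-adjoint, the six terms cancel in pairs. The connection is metric, so \<open>\<nabla>\<^sub>i S\<close> is self-adjoint
  as soon as \<open>S\<close> is (\<open>nabla_schouten_self_adjoint\<close>), and this amounts to the symmetry of the Ricci
  tensor (\<open>ricci_sym\<close>). The latter follows in the usual way from the pair symmetry of the curvature
  tensor, hence from the first Bianchi identity and the two skew symmetries.

  Most of the work lies in making these manipulations legitimate. The skew symmetry of
  \<open>g (R(X, Y) Z) V\<close> in \<open>Z\<close> and \<open>V\<close> needs the identity \<open>X (Y f) - Y (X f) = [X, Y] f\<close>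
  (\<open>lie_bracket_commutator\<close>), which in a chart is the symmetry of mixed second derivatives
  (\<open>mixed_derivatives_commute\<close>). The product rule for \<open>\<nabla>\<^sub>X (S Y)\<close> needs \<open>S Y\<close> to be a smooth field.
  The curvature at a point is evaluated on fields that are constant in a chart chosen arbitrarily at
  that point, so nothing can be read off about its dependence on the point until it is shown to be
  tensorial (\<open>curvature_eq\<close>). Then it may be computed with the coordinate fields of one fixed chart,
  and Cramer's rule for the Gram matrix makes the associated endomorphism smooth
  (\<open>smooth_field_schouten\<close>). Finally, the Hodge star is given by a description that must be shown
  to be satisfiable (\<open>hodge_star\<close>).\<close>


section \<open>Calculus of smooth maps\<close>

lemma Ck_on_cong:
  assumes "open S" and "\<And>x. x \<in> S \<Longrightarrow> f x = g x" and "Ck_on k f S"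
  shows "Ck_on k g S"
  using assms(2,3)
proof (induction k arbitrary: f g)
  case 0
  then show ?case by (metis Ck_on.simps(1) continuous_on_cong)
next
  case (Suc k)
  have d: "f differentiable at x" if "x \<in> S" for x using Suc.prems that by simp
  have "g differentiable at x" if "x \<in> S" for x
    using d[OF that] Suc.prems(1) \<open>open S\<close> that
    by (meson differentiable_def has_derivative_transform_within_open)
  moreover have "frechet_derivative f (at x) = frechet_derivative g (at x)" if "x \<in> S" for x
    using frechet_derivative_transform_within_open d Suc.prems(1) \<open>open S\<close> that by blast
  moreover have "Ck_on k (\<lambda>x. frechet_derivative g (at x) v) S" for v
    using Suc.IH[of "\<lambda>x. frechet_derivative f (at x) v"] Suc.prems calculation(2) by simp
  ultimately show ?case by simp
qed

lemma Ck_on_Suc_imp: "Ck_on (Suc k) f S \<Longrightarrow> Ck_on k f S"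
proof (induction k arbitrary: f)
  case 0
  then show ?case
    by (simp add: continuous_at_imp_continuous_on differentiable_imp_continuous_within)
qed auto

lemma Ck_on_has_derivative:
  "Ck_on (Suc k) f S \<Longrightarrow> x \<in> S \<Longrightarrow> (f has_derivative frechet_derivative f (at x)) (at x)"
  by (simp add: frechet_derivative_works[symmetric])

lemma Ck_on_const: "Ck_on k (\<lambda>x. c) S"
  by (induction k arbitrary: c) auto

lemma Ck_on_bounded_linear: "bounded_linear L \<Longrightarrow> Ck_on k L S"
proof (cases k)
  case 0
  then show "bounded_linear L \<Longrightarrow> ?thesis" by (simp add: linear_continuous_on)
next
  case (Suc j)
  assume L: "bounded_linear L"
  have "frechet_derivative L (at x) = L" for x
    using L by (metis bounded_linear_imp_has_derivative frechet_derivative_at)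
  with Suc L show ?thesis by (simp add: bounded_linear_imp_differentiable Ck_on_const)
qed

lemma Ck_on_add:
  assumes "open S"
  shows "Ck_on k f S \<Longrightarrow> Ck_on k g S \<Longrightarrow> Ck_on k (\<lambda>x. f x + g x) S"
proof (induction k arbitrary: f g)
  case 0
  then show ?case by (simp add: continuous_on_add)
next
  case (Suc k)
  have der: "((\<lambda>x. f x + g x) has_derivative (\<lambda>v. frechet_derivative f (at x) v
      + frechet_derivative g (at x) v)) (at x)" if "x \<in> S" for x
    using Suc.prems that by (intro has_derivative_add Ck_on_has_derivative)
  have "Ck_on k (\<lambda>x. frechet_derivative f (at x) v + frechet_derivative g (at x) v) S" for v
    using Suc by simp
  then show ?case
    using der by (auto simp: differentiable_def frechet_derivative_at[OF der, symmetric]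
        intro: Ck_on_cong[OF assms])
qed

text \<open>The product rule is the only analytic input: the derivative of a bilinear product is a sum of
  two products whose factors are, by induction, one order less smooth.\<close>

lemma Ck_on_bilinear:
  assumes "bounded_bilinear B" and "open S"
  shows "Ck_on k f S \<Longrightarrow> Ck_on k g S \<Longrightarrow> Ck_on k (\<lambda>x. B (f x) (g x)) S"
proof (induction k arbitrary: f g)
  case 0
  then show ?case using bounded_bilinear.continuous_on[OF assms(1)] by simp
next
  case (Suc k)
  have der: "((\<lambda>x. B (f x) (g x)) has_derivative (\<lambda>v. B (f x) (frechet_derivative g (at x) v)
      + B (frechet_derivative f (at x) v) (g x))) (at x)" if "x \<in> S" for x
    using Suc.prems that by (intro bounded_bilinear.FDERIV[OF assms(1)] Ck_on_has_derivative)
  have "Ck_on k (\<lambda>x. B (f x) (frechet_derivative g (at x) v)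
      + B (frechet_derivative f (at x) v) (g x)) S" for v
    using Suc.prems Ck_on_Suc_imp[OF Suc.prems(1)] Ck_on_Suc_imp[OF Suc.prems(2)]
    by (intro Ck_on_add[OF assms(2)] Suc.IH) auto
  then show ?case
    using der by (auto simp: differentiable_def frechet_derivative_at[OF der, symmetric]
        intro: Ck_on_cong[OF assms(2)])
qed

lemma Ck_on_bounded_linear_comp:
  assumes "bounded_linear L" "open S"
  shows "Ck_on k f S \<Longrightarrow> Ck_on k (\<lambda>x. L (f x)) S"
proof (induction k arbitrary: f)
  case 0
  then show ?case using bounded_linear.continuous_on[OF assms(1)] by simp
next
  case (Suc k)
  have der: "((\<lambda>x. L (f x)) has_derivative (\<lambda>v. L (frechet_derivative f (at x) v))) (at x)"
    if "x \<in> S" for x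
    using Suc.prems that by (intro bounded_linear.has_derivative[OF assms(1)] Ck_on_has_derivative)
  have "Ck_on k (\<lambda>x. L (frechet_derivative f (at x) v)) S" for v
    using Suc by simp
  then show ?case
    using der by (auto simp: differentiable_def frechet_derivative_at[OF der, symmetric]
        intro: Ck_on_cong[OF assms(2)])
qed

lemma Ck_on_sum:
  assumes "open S" "finite I" "\<And>i. i \<in> I \<Longrightarrow> Ck_on k (f i) S"
  shows "Ck_on k (\<lambda>x. \<Sum>i\<in>I. f i x) S"
  using assms(2,3) by (induction) (auto intro: Ck_on_add[OF assms(1)] Ck_on_const)

text \<open>The derivative of \<open>1/f\<close> is \<open>- (1/f) f' (1/f)\<close>, in which \<open>1/f\<close> is needed only to one order less.\<close>

lemma Ck_on_inverse:
  fixes f :: "'a::real_normed_vector \<Rightarrow> real"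
  assumes "open S" "\<And>x. x \<in> S \<Longrightarrow> f x \<noteq> 0"
  shows "Ck_on k f S \<Longrightarrow> Ck_on k (\<lambda>x. inverse (f x)) S"
proof (induction k)
  case 0
  then show ?case using assms(2) by (simp add: continuous_on_inverse)
next
  case (Suc k)
  note mult = Ck_on_bilinear[OF bounded_bilinear_mult \<open>open S\<close>]
  have der: "((\<lambda>x. inverse (f x)) has_derivative (\<lambda>v. - (inverse (f x)
      * frechet_derivative f (at x) v * inverse (f x)))) (at x)" if "x \<in> S" for x
    using Suc.prems that assms(2)
    by (auto intro!: has_derivative_inverse simp: frechet_derivative_works)
  have "Ck_on k (\<lambda>x. - (inverse (f x) * frechet_derivative f (at x) v * inverse (f x))) S" for v
    using Suc.IH[OF Ck_on_Suc_imp[OF Suc.prems]] Suc.prems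
    by (intro Ck_on_bounded_linear_comp[OF bounded_linear_minus[OF bounded_linear_ident]] mult assms) auto
  then show ?case
    using der by (auto simp: differentiable_def frechet_derivative_at[OF der, symmetric]
        intro: Ck_on_cong[OF assms(1)])
qed

lemma frechet_derivative_Basis:
  fixes f :: "'a::euclidean_space \<Rightarrow> 'b::real_normed_vector"
  assumes "f differentiable at x"
  shows "frechet_derivative f (at x) v = (\<Sum>b\<in>Basis. (v \<bullet> b) *\<^sub>R frechet_derivative f (at x) b)"
proof -
  interpret linear "frechet_derivative f (at x)" by (rule linear_frechet_derivative[OF assms])
  show ?thesis by (subst euclidean_representation[of v, symmetric]) (simp only: sum scaleR)
qed

text \<open>Expanding the chain rule over a basis of the intermediate space turns the derivative of a
  composition into a sum of products of one order less smooth maps.\<close>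

lemma Ck_on_compose:
  fixes F :: "'b::euclidean_space \<Rightarrow> 'c::real_normed_vector"
    and G :: "'a::real_normed_vector \<Rightarrow> 'b"
  assumes "open S" "G ` S \<subseteq> T"
  shows "Ck_on k F T \<Longrightarrow> Ck_on k G S \<Longrightarrow> Ck_on k (\<lambda>x. F (G x)) S"
proof (induction k arbitrary: F)
  case 0
  then show ?case using assms continuous_on_compose2 by auto
next
  case (Suc k)
  have der: "((\<lambda>x. F (G x)) has_derivative
      (\<lambda>v. frechet_derivative F (at (G x)) (frechet_derivative G (at x) v))) (at x)"
    if "x \<in> S" for x
    using Suc.prems that assms(2)
    by (intro has_derivative_compose[where f = G and g = F] Ck_on_has_derivative) auto
  have eq: "frechet_derivative (\<lambda>x. F (G x)) (at x) v = (\<Sum>b\<in>Basis.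
      (frechet_derivative G (at x) v \<bullet> b) *\<^sub>R frechet_derivative F (at (G x)) b)" if "x \<in> S" for x v
  proof -
    have "F differentiable at (G x)" using Suc.prems(1) that assms(2) by auto
    then show ?thesis
      unfolding frechet_derivative_at[OF der[OF that], symmetric] by (rule frechet_derivative_Basis)
  qed
  have "Ck_on k (\<lambda>x. \<Sum>b\<in>Basis. (frechet_derivative G (at x) v \<bullet> b)
          *\<^sub>R frechet_derivative F (at (G x)) b) S" for v
    using Suc.prems Ck_on_Suc_imp[OF Suc.prems(2)]
    by (intro Ck_on_sum[OF assms(1) finite_Basis] Ck_on_bilinear[OF bounded_bilinear_scaleR assms(1)]
        Ck_on_bounded_linear_comp[OF bounded_linear_inner_left assms(1)]
        Suc.IH[where F = "\<lambda>y. frechet_derivative F (at y) b" for b]) auto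
  then show ?case
    using der eq by (auto simp: differentiable_def intro: Ck_on_cong[OF assms(1)])
qed

lemma smooth_on_cong:
  "open S \<Longrightarrow> (\<And>x. x \<in> S \<Longrightarrow> f x = g x) \<Longrightarrow> smooth_on f S \<Longrightarrow> smooth_on g S"
  using Ck_on_cong unfolding smooth_on_def by metis

lemma smooth_on_subset:
  assumes "smooth_on f S" "T \<subseteq> S"
  shows "smooth_on f T"
proof -
  have "Ck_on k f S \<Longrightarrow> Ck_on k f T" for k
    using assms(2) by (induction k arbitrary: f) (auto intro: continuous_on_subset)
  then show ?thesis using assms(1) by (simp add: smooth_on_def)
qed

lemma smooth_on_differentiable: "smooth_on f S \<Longrightarrow> x \<in> S \<Longrightarrow> f differentiable at x"
  unfolding smooth_on_def by (metis Ck_on.simps(2))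

lemma smooth_on_continuous: "smooth_on f S \<Longrightarrow> continuous_on S f"
  unfolding smooth_on_def by (metis Ck_on.simps(1))

lemma smooth_on_derivative: "smooth_on f S \<Longrightarrow> smooth_on (\<lambda>x. frechet_derivative f (at x) v) S"
  unfolding smooth_on_def by (metis Ck_on.simps(2))

lemma smooth_on_const: "smooth_on (\<lambda>x. c) S"
  by (simp add: smooth_on_def Ck_on_const)

lemma smooth_on_ident: "smooth_on (\<lambda>x. x) S"
  by (simp add: smooth_on_def Ck_on_bounded_linear)

lemma smooth_on_add:
  "open S \<Longrightarrow> smooth_on f S \<Longrightarrow> smooth_on g S \<Longrightarrow> smooth_on (\<lambda>x. f x + g x) S"
  by (simp add: smooth_on_def Ck_on_add)

lemma smooth_on_sum:
  "open S \<Longrightarrow> finite I \<Longrightarrow> (\<And>i. i \<in> I \<Longrightarrow> smooth_on (f i) S) \<Longrightarrow> smooth_on (\<lambda>x. \<Sum>i\<in>I. f i x) S"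
  by (simp add: smooth_on_def Ck_on_sum)

lemma smooth_on_scaleR:
  "open S \<Longrightarrow> smooth_on f S \<Longrightarrow> smooth_on g S \<Longrightarrow> smooth_on (\<lambda>x. f x *\<^sub>R g x) S"
  by (simp add: smooth_on_def Ck_on_bilinear[OF bounded_bilinear_scaleR])

lemma smooth_on_inverse:
  "open S \<Longrightarrow> (\<And>x. x \<in> S \<Longrightarrow> f x \<noteq> 0) \<Longrightarrow> smooth_on f S \<Longrightarrow> smooth_on (\<lambda>x. inverse (f x :: real)) S"
  by (simp add: smooth_on_def Ck_on_inverse)

lemma smooth_on_bounded_linear_comp:
  "bounded_linear L \<Longrightarrow> open S \<Longrightarrow> smooth_on f S \<Longrightarrow> smooth_on (\<lambda>x. L (f x)) S"
  by (simp add: smooth_on_def Ck_on_bounded_linear_comp)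

lemma smooth_on_compose:
  fixes F :: "'b::euclidean_space \<Rightarrow> 'c::real_normed_vector"
  assumes "smooth_on F T" "smooth_on G S" "open S" "G ` S \<subseteq> T"
  shows "smooth_on (\<lambda>x. F (G x)) S"
  using assms by (auto simp: smooth_on_def intro: Ck_on_compose)

lemma smooth_on_derivative_along:
  fixes F :: "'b::euclidean_space \<Rightarrow> 'c::real_normed_vector"
  assumes "smooth_on F S" "smooth_on Y S" "open S"
  shows "smooth_on (\<lambda>x. frechet_derivative F (at x) (Y x)) S"
proof -
  have "smooth_on (\<lambda>x. \<Sum>b\<in>Basis. (Y x \<bullet> b) *\<^sub>R frechet_derivative F (at x) b) S"
    using assms by (intro smooth_on_sum smooth_on_scaleR finite_Basis smooth_on_derivative
        smooth_on_bounded_linear_comp[OF bounded_linear_inner_left])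
  then show ?thesis
    by (rule smooth_on_cong[rotated 2])
      (auto simp: assms(3) frechet_derivative_Basis[symmetric] smooth_on_differentiable[OF assms(1)])
qed

text \<open>The symmetric second difference over a parallelogram equals the mixed derivative at some
  point of it, by applying the mean value theorem once in each direction.\<close>

lemma second_difference_mean_value:
  fixes f :: "'a::real_normed_vector \<Rightarrow> real"
  assumes f: "smooth_on f S" and h: "h > 0"
    and P: "\<And>s t. 0 \<le> s \<Longrightarrow> s \<le> h \<Longrightarrow> 0 \<le> t \<Longrightarrow> t \<le> h \<Longrightarrow> x + s *\<^sub>R a + t *\<^sub>R b \<in> S"
  obtains s t where "0 \<le> s" "s \<le> h" "0 \<le> t" "t \<le> h"
    "f (x + h *\<^sub>R a + h *\<^sub>R b) - f (x + h *\<^sub>R a) - f (x + h *\<^sub>R b) + f x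
      = h\<^sup>2 * frechet_derivative (\<lambda>y. frechet_derivative f (at y) a) (at (x + s *\<^sub>R a + t *\<^sub>R b)) b"
proof -
  let ?Da = "\<lambda>y. frechet_derivative f (at y) a"
  have line: "((\<lambda>s. F (y + s *\<^sub>R v)) has_real_derivative frechet_derivative F (at (y + s *\<^sub>R v)) v) (at s)"
    if "F differentiable at (y + s *\<^sub>R v)" for F :: "'a \<Rightarrow> real" and y v s
  proof -
    have "((\<lambda>s. y + s *\<^sub>R v) has_derivative (\<lambda>r. r *\<^sub>R v)) (at s)"
      by (auto intro!: derivative_eq_intros)
    from has_derivative_compose[OF this, of F] that
    have "((\<lambda>s. F (y + s *\<^sub>R v)) has_derivative
        (\<lambda>r. frechet_derivative F (at (y + s *\<^sub>R v)) (r *\<^sub>R v))) (at s)"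
      by (simp add: frechet_derivative_works)
    moreover have "(\<lambda>r. frechet_derivative F (at (y + s *\<^sub>R v)) (r *\<^sub>R v))
        = (*) (frechet_derivative F (at (y + s *\<^sub>R v)) v)"
      using linear_cmul[OF linear_frechet_derivative[OF that]] by (simp add: fun_eq_iff)
    ultimately show ?thesis by (simp add: has_field_derivative_def)
  qed
  have 1: "((\<lambda>s. f (x + s *\<^sub>R a + h *\<^sub>R b) - f (x + s *\<^sub>R a)) has_real_derivative
      ?Da (x + s *\<^sub>R a + h *\<^sub>R b) - ?Da (x + s *\<^sub>R a)) (at s)" if "0 \<le> s" "s \<le> h" for s
  proof -
    have "x + h *\<^sub>R b + s *\<^sub>R a \<in> S" "x + s *\<^sub>R a \<in> S"
      using P[of s h] P[of s 0] that h by (simp_all add: add.assoc add.commute add.left_commute)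
    then show ?thesis
      using DERIV_diff[OF line[of f "x + h *\<^sub>R b" s a] line[of f x s a]]
        smooth_on_differentiable[OF f]
      by (simp add: add.assoc add.commute add.left_commute)
  qed
  obtain s where s: "0 < s" "s < h" and
    seq: "f (x + h *\<^sub>R a + h *\<^sub>R b) - f (x + h *\<^sub>R a) - (f (x + h *\<^sub>R b) - f x)
      = h * (?Da (x + s *\<^sub>R a + h *\<^sub>R b) - ?Da (x + s *\<^sub>R a))"
    using MVT2[OF h 1] by auto
  have 2: "((\<lambda>t. ?Da (x + s *\<^sub>R a + t *\<^sub>R b)) has_real_derivative
      frechet_derivative ?Da (at (x + s *\<^sub>R a + t *\<^sub>R b)) b) (at t)" if "0 \<le> t" "t \<le> h" for t
    using P[of s t] that s smooth_on_differentiable[OF smooth_on_derivative[OF f]]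
    by (intro line) auto
  obtain t where "0 < t" "t < h" and
    "?Da (x + s *\<^sub>R a + h *\<^sub>R b) - ?Da (x + s *\<^sub>R a)
      = h * frechet_derivative ?Da (at (x + s *\<^sub>R a + t *\<^sub>R b)) b"
    using MVT2[OF h 2] by auto
  then show thesis
    using that[of s t] s seq by (simp add: power2_eq_square algebra_simps)
qed

lemma small_parallelogram_in_ball:
  fixes a b :: "'a::real_normed_vector"
  assumes "d > 0"
  obtains h where "h > 0" "\<And>s t. 0 \<le> s \<Longrightarrow> s \<le> h \<Longrightarrow> 0 \<le> t \<Longrightarrow> t \<le> h \<Longrightarrow>
    x + s *\<^sub>R a + t *\<^sub>R b \<in> ball x d"
proof
  let ?h = "d / (norm a + norm b + 1)"
  have pos: "norm a + norm b + 1 > 0" by (smt (verit) norm_ge_zero)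
  then show h: "?h > 0" using assms by simp
  fix s t assume st: "0 \<le> s" "s \<le> ?h" "0 \<le> t" "t \<le> ?h"
  have "norm (s *\<^sub>R a + t *\<^sub>R b) \<le> s * norm a + t * norm b"
    using st by (metis abs_of_nonneg norm_scaleR norm_triangle_ineq)
  also have "\<dots> \<le> ?h * norm a + ?h * norm b"
    using st by (intro add_mono mult_right_mono) auto
  also have "\<dots> < ?h * (norm a + norm b + 1)"
    using h by (simp only: distrib_left)
  also have "\<dots> = d" using pos by simp
  finally have "norm (s *\<^sub>R a + t *\<^sub>R b) < d" .
  moreover have "dist x (x + u) = norm u" for u by (simp add: dist_norm)
  ultimately show "x + s *\<^sub>R a + t *\<^sub>R b \<in> ball x d"
    by (simp add: add.assoc)
qed

text \<open>Both mixed derivatives are limits of the same second difference quotients.\<close>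

lemma mixed_derivatives_commute:
  fixes f :: "'a::real_normed_vector \<Rightarrow> real"
  assumes "smooth_on f S" "open S" "x \<in> S"
  shows "frechet_derivative (\<lambda>y. frechet_derivative f (at y) a) (at x) b
       = frechet_derivative (\<lambda>y. frechet_derivative f (at y) b) (at x) a"
proof -
  define D where "D = (\<lambda>u v y. frechet_derivative (\<lambda>y. frechet_derivative f (at y) u) (at y) v)"
  have cont: "continuous_on S (D u v)" for u v
    unfolding D_def using assms by (intro smooth_on_continuous smooth_on_derivative)
  have "\<bar>D a b x - D b a x\<bar> \<le> 0 + 2 * e" if "e > 0" for e
  proof -
    obtain d where d: "d > 0" "ball x d \<subseteq> S"
      and da: "\<And>y. y \<in> ball x d \<Longrightarrow> \<bar>D a b y - D a b x\<bar> < e"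
      and db: "\<And>y. y \<in> ball x d \<Longrightarrow> \<bar>D b a y - D b a x\<bar> < e"
    proof -
      obtain d0 where "d0 > 0" "ball x d0 \<subseteq> S" using assms openE by blast
      moreover obtain d1 where "d1 > 0" "\<And>y. y \<in> S \<Longrightarrow> dist y x < d1 \<Longrightarrow> dist (D a b y) (D a b x) < e"
        using cont[of a b] \<open>x \<in> S\<close> \<open>e > 0\<close> unfolding continuous_on_iff by meson
      moreover obtain d2 where "d2 > 0" "\<And>y. y \<in> S \<Longrightarrow> dist y x < d2 \<Longrightarrow> dist (D b a y) (D b a x) < e"
        using cont[of b a] \<open>x \<in> S\<close> \<open>e > 0\<close> unfolding continuous_on_iff by meson
      ultimately show thesis
        using that[of "min d0 (min d1 d2)"] by (auto simp: dist_real_def dist_commute subset_iff)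
    qed
    obtain h where h: "h > 0" and P: "\<And>s t. 0 \<le> s \<Longrightarrow> s \<le> h \<Longrightarrow> 0 \<le> t \<Longrightarrow> t \<le> h \<Longrightarrow>
        x + s *\<^sub>R a + t *\<^sub>R b \<in> ball x d"
      using small_parallelogram_in_ball[OF d(1)] by blast
    have Pab: "x + s *\<^sub>R a + t *\<^sub>R b \<in> S" if "0 \<le> s" "s \<le> h" "0 \<le> t" "t \<le> h" for s t
      using P[OF that] d(2) by blast
    have Pba: "x + s *\<^sub>R b + t *\<^sub>R a \<in> S" if "0 \<le> s" "s \<le> h" "0 \<le> t" "t \<le> h" for s t
      using Pab[of t s] that by (simp add: add.assoc add.commute add.left_commute)
    obtain s t where 1: "0 \<le> s" "s \<le> h" "0 \<le> t" "t \<le> h"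
      "f (x + h *\<^sub>R a + h *\<^sub>R b) - f (x + h *\<^sub>R a) - f (x + h *\<^sub>R b) + f x
        = h\<^sup>2 * D a b (x + s *\<^sub>R a + t *\<^sub>R b)"
      unfolding D_def by (rule second_difference_mean_value[OF assms(1) h Pab])
    obtain s' t' where 2: "0 \<le> s'" "s' \<le> h" "0 \<le> t'" "t' \<le> h"
      "f (x + h *\<^sub>R b + h *\<^sub>R a) - f (x + h *\<^sub>R b) - f (x + h *\<^sub>R a) + f x
        = h\<^sup>2 * D b a (x + s' *\<^sub>R b + t' *\<^sub>R a)"
      unfolding D_def by (rule second_difference_mean_value[OF assms(1) h Pba])
    have in_ball: "x + s' *\<^sub>R b + t' *\<^sub>R a \<in> ball x d"
      using P[of t' s'] 2(1-4) by (simp add: add.assoc add.commute add.left_commute)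
    have "h\<^sup>2 * D a b (x + s *\<^sub>R a + t *\<^sub>R b) = h\<^sup>2 * D b a (x + s' *\<^sub>R b + t' *\<^sub>R a)"
      using 1(5) 2(5) by (simp add: algebra_simps)
    then have "D a b (x + s *\<^sub>R a + t *\<^sub>R b) = D b a (x + s' *\<^sub>R b + t' *\<^sub>R a)"
      using h by simp
    then show ?thesis using da[OF P[OF 1(1-4)]] db[OF in_ball] by linarith
  qed
  note close = this
  have "\<bar>D a b x - D b a x\<bar> \<le> 0"
  proof (rule field_le_epsilon)
    fix e :: real assume "e > 0"
    then show "\<bar>D a b x - D b a x\<bar> \<le> 0 + e" using close[of "e / 2"] by simp
  qed
  then show ?thesis by (simp add: D_def)
qed

section \<open>Charts, components and frames\<close>

context smooth_3manifold
begin

lemma inj_on_chart: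
  assumes "c \<in> A"
  shows "inj_on (snd c) (fst c)"
proof -
  have "fst c \<subseteq> topspace M" using chart_domain[OF assms] openin_subset by blast
  then show ?thesis
    using homeomorphic_imp_injective_map[OF chart_homeo[OF assms]]
    by (simp add: Int_absorb1)
qed

lemma chart_inv_chart [simp]: "c \<in> A \<Longrightarrow> q \<in> fst c \<Longrightarrow> chart_inv c (snd c q) = q"
  by (simp add: chart_inv_def inj_on_chart)

lemma open_chart_image:
  assumes "c \<in> A" "openin M W"
  shows "open (snd c ` (W \<inter> fst c))"
proof -
  have "openin (subtopology M (fst c)) (W \<inter> fst c)"
    using assms(2) by (auto simp: openin_subtopology)
  then have "openin (top_of_set (snd c ` fst c)) (snd c ` (W \<inter> fst c))"
    using homeomorphic_imp_open_map[OF chart_homeo[OF assms(1)]] by (auto simp: open_map_def)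
  then show ?thesis using chart_range[OF assms(1)] openin_open_trans by blast
qed

lemma open_chart_image': "c \<in> A \<Longrightarrow> openin M W \<Longrightarrow> W \<subseteq> fst c \<Longrightarrow> open (snd c ` W)"
  using open_chart_image[of c W] by (simp add: Int_absorb2)

lemma chart_at:
  assumes "q \<in> topspace M"
  shows "chart_at q \<in> A" and "q \<in> fst (chart_at q)"
  using assms someI_ex[of "\<lambda>c. c \<in> A \<and> q \<in> fst c"]
  unfolding chart_at_def atlas_cover by blast+

lemma chart_topspace: "c \<in> A \<Longrightarrow> q \<in> fst c \<Longrightarrow> q \<in> topspace M"
  using atlas_cover by blast

lemma transition_chart [simp]:
  "c \<in> A \<Longrightarrow> q \<in> fst c \<Longrightarrow> transition c d (snd c q) = snd d q"
  by (simp add: transition_def)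

lemma transition_has_derivative:
  assumes "c \<in> A" "d \<in> A" "q \<in> fst c" "q \<in> fst d"
  shows "(transition c d has_derivative tangent_change c d q) (at (snd c q))"
  using smooth_on_differentiable[OF smooth_transition[OF assms(1,2)]] assms
  by (auto simp: tangent_change_def frechet_derivative_works)

lemma linear_tangent_change:
  assumes "c \<in> A" "d \<in> A" "q \<in> fst c" "q \<in> fst d"
  shows "linear (tangent_change c d q)"
  using transition_has_derivative[OF assms] has_derivative_linear by blast

lemma tangent_change_trans:
  assumes "c \<in> A" "d \<in> A" "e \<in> A" "q \<in> fst c" "q \<in> fst d" "q \<in> fst e"
  shows "tangent_change d e q (tangent_change c d q v) = tangent_change c e q v"
proof -
  have "(transition d e \<circ> transition c d has_derivative
      tangent_change d e q \<circ> tangent_change c d q) (at (snd c q))"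
    using assms by (intro diff_chain_at transition_has_derivative) (auto intro: transition_has_derivative)
  moreover have "open (snd c ` (fst d \<inter> fst c))"
    using assms chart_domain by (intro open_chart_image)
  ultimately have "(transition c e has_derivative tangent_change d e q \<circ> tangent_change c d q) (at (snd c q))"
    by (rule has_derivative_transform_within_open) (use assms in auto)
  then show ?thesis
    using has_derivative_unique[OF transition_has_derivative[OF assms(1,3,4,6)]] by simp
qed

lemma tangent_change_id:
  assumes "c \<in> A" "q \<in> fst c"
  shows "tangent_change c c q v = v"
proof -
  have "((\<lambda>x. x) has_derivative (\<lambda>x. x)) (at (snd c q))" by simp
  then have "(transition c c has_derivative (\<lambda>x. x)) (at (snd c q))"
    by (rule has_derivative_transform_within_open[OF _ chart_range[OF assms(1)]]) (use assms in auto)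
  then show ?thesis
    using has_derivative_unique[OF transition_has_derivative[OF assms(1,1,2,2)]] by simp
qed

text \<open>Tangent vectors at \<open>q\<close> are stored by their components in a chart that depends on \<open>q\<close>. The next two
  operations, inverse to each other, translate to and from one fixed chart \<open>c\<close>; as a function of the
  point, \<open>frame c v\<close> is the vector field with constant components \<open>v\<close> in \<open>c\<close>.\<close>

definition components :: "'a chart \<Rightarrow> 'a \<Rightarrow> real^3 \<Rightarrow> real^3" where
  "components c q = tangent_change (chart_at q) c q"

definition frame :: "'a chart \<Rightarrow> real^3 \<Rightarrow> 'a \<Rightarrow> real^3" where
  "frame c v q = tangent_change c (chart_at q) q v"

lemma extend_eq_frame: "extend p v = frame (chart_at p) v"
  by (simp add: extend_def frame_def fun_eq_iff)

lemma linear_components: "c \<in> A \<Longrightarrow> q \<in> fst c \<Longrightarrow> linear (components c q)"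
  unfolding components_def by (intro linear_tangent_change chart_at chart_topspace)

lemma linear_frame: "c \<in> A \<Longrightarrow> q \<in> fst c \<Longrightarrow> linear (\<lambda>v. frame c v q)"
  unfolding frame_def by (intro linear_tangent_change chart_at chart_topspace)

lemma components_frame [simp]: "c \<in> A \<Longrightarrow> q \<in> fst c \<Longrightarrow> components c q (frame c v q) = v"
  unfolding frame_def components_def
  by (simp add: tangent_change_trans tangent_change_id chart_at[OF chart_topspace])

lemma frame_components [simp]: "c \<in> A \<Longrightarrow> q \<in> fst c \<Longrightarrow> frame c (components c q v) q = v"
  unfolding frame_def components_def
  by (simp add: tangent_change_trans tangent_change_id chart_at[OF chart_topspace])

lemma components_chart_at [simp]: "q \<in> topspace M \<Longrightarrow> components (chart_at q) q v = v"
  by (simp add: components_def tangent_change_id chart_at)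

lemma frame_chart_at [simp]: "q \<in> topspace M \<Longrightarrow> frame (chart_at q) v q = v"
  by (simp add: frame_def tangent_change_id chart_at)

lemma components_change:
  assumes "c \<in> A" "d \<in> A" "q \<in> fst c" "q \<in> fst d"
  shows "components d q v = tangent_change c d q (components c q v)"
  using assms by (simp add: components_def tangent_change_trans chart_at[OF chart_topspace])

lemma field_rep_chart [simp]:
  "c \<in> A \<Longrightarrow> q \<in> fst c \<Longrightarrow> field_rep c X (snd c q) = components c q (X q)"
  by (simp add: field_rep_def components_def)


section \<open>Smooth functions and vector fields on a manifold\<close>

text \<open>Smoothness on a subset of one chart need only be checked in that chart, because coordinate
  changes are smooth.\<close>

lemma smooth_fun_in_chart:
  assumes "c \<in> A" "openin M W" "W \<subseteq> fst c"
  shows "smooth_fun W f \<longleftrightarrow> smooth_on (f \<circ> chart_inv c) (snd c ` W)"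
proof
  assume "smooth_fun W f"
  then show "smooth_on (f \<circ> chart_inv c) (snd c ` W)"
    using assms by (auto simp: smooth_fun_def Int_absorb2)
next
  assume f: "smooth_on (f \<circ> chart_inv c) (snd c ` W)"
  show "smooth_fun W f" unfolding smooth_fun_def
  proof
    fix d assume d: "d \<in> A"
    let ?S = "snd d ` (W \<inter> fst d)"
    have S: "open ?S" using open_chart_image[OF d assms(2)] .
    have "smooth_on (transition d c) ?S"
      by (rule smooth_on_subset[OF smooth_transition[OF d assms(1)]]) (use assms(3) in blast)
    moreover have "transition d c ` ?S \<subseteq> snd c ` W" using d by auto
    ultimately have "smooth_on (\<lambda>x. (f \<circ> chart_inv c) (transition d c x)) ?S"
      using smooth_on_compose[OF f _ S] by blast
    then show "smooth_on (f \<circ> chart_inv d) ?S"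
      by (rule smooth_on_cong[OF S, rotated]) (use d assms in auto)
  qed
qed

lemma smooth_field_in_chart:
  assumes "c \<in> A" "openin M W" "W \<subseteq> fst c"
  shows "smooth_field W X \<longleftrightarrow> smooth_on (field_rep c X) (snd c ` W)"
proof
  assume "smooth_field W X"
  then show "smooth_on (field_rep c X) (snd c ` W)"
    using assms by (auto simp: smooth_field_def Int_absorb2)
next
  assume X: "smooth_on (field_rep c X) (snd c ` W)"
  show "smooth_field W X" unfolding smooth_field_def
  proof
    fix d assume d: "d \<in> A"
    let ?S = "snd d ` (W \<inter> fst d)" and ?T = "snd c ` (W \<inter> fst d)"
    have S: "open ?S" using open_chart_image[OF d assms(2)] .
    have "openin M (W \<inter> fst d)" using assms(2) chart_domain[OF d] by blast
    then have T: "open ?T" using assms(3) by (intro open_chart_image'[OF assms(1)]) auto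
    have "smooth_on (transition c d) ?T"
      by (rule smooth_on_subset[OF smooth_transition[OF assms(1) d]]) (use assms(3) in blast)
    moreover have "smooth_on (field_rep c X) ?T"
      by (rule smooth_on_subset[OF X]) blast
    ultimately have F: "smooth_on (\<lambda>x. frechet_derivative (transition c d) (at x) (field_rep c X x)) ?T"
      using T by (rule smooth_on_derivative_along)
    have "smooth_on (transition d c) ?S"
      by (rule smooth_on_subset[OF smooth_transition[OF d assms(1)]]) (use assms(3) in blast)
    moreover have "transition d c ` ?S \<subseteq> ?T" using d by auto
    ultimately have "smooth_on (\<lambda>x. frechet_derivative (transition c d) (at (transition d c x))
        (field_rep c X (transition d c x))) ?S"
      using smooth_on_compose[OF F _ S] by blast
    then show "smooth_on (field_rep d X) ?S"
      by (rule smooth_on_cong[OF S, rotated])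
        (use d assms components_change[OF assms(1) d] in \<open>auto simp: tangent_change_def subset_iff\<close>)
  qed
qed

lemma smooth_fun_subset: "smooth_fun W f \<Longrightarrow> V \<subseteq> W \<Longrightarrow> smooth_fun V f"
  unfolding smooth_fun_def by (meson Int_mono image_mono order_refl smooth_on_subset)

lemma smooth_field_subset: "smooth_field W X \<Longrightarrow> V \<subseteq> W \<Longrightarrow> smooth_field V X"
  unfolding smooth_field_def by (meson Int_mono image_mono order_refl smooth_on_subset)

lemma smooth_fun_cong:
  assumes "openin M W" "smooth_fun W f" "\<And>q. q \<in> W \<Longrightarrow> f q = h q"
  shows "smooth_fun W h"
  unfolding smooth_fun_def
proof
  fix c assume c: "c \<in> A"
  have "smooth_on (f \<circ> chart_inv c) (snd c ` (W \<inter> fst c))"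
    using assms(2) c by (auto simp: smooth_fun_def)
  then show "smooth_on (h \<circ> chart_inv c) (snd c ` (W \<inter> fst c))"
    by (rule smooth_on_cong[OF open_chart_image[OF c assms(1)], rotated]) (use assms c in auto)
qed

lemma smooth_field_cong:
  assumes "openin M W" "smooth_field W X" "\<And>q. q \<in> W \<Longrightarrow> X q = Y q"
  shows "smooth_field W Y"
  unfolding smooth_field_def
proof
  fix c assume c: "c \<in> A"
  have "smooth_on (field_rep c X) (snd c ` (W \<inter> fst c))"
    using assms(2) c by (auto simp: smooth_field_def)
  then show "smooth_on (field_rep c Y) (snd c ` (W \<inter> fst c))"
    by (rule smooth_on_cong[OF open_chart_image[OF c assms(1)], rotated]) (use assms c in auto)
qed

lemma smooth_fun_const: "smooth_fun W (\<lambda>q. k)"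
  by (simp add: smooth_fun_def o_def smooth_on_const)

lemma smooth_fun_add:
  "openin M W \<Longrightarrow> smooth_fun W f \<Longrightarrow> smooth_fun W h \<Longrightarrow> smooth_fun W (\<lambda>q. f q + h q)"
  by (auto simp: smooth_fun_def o_def intro!: smooth_on_add open_chart_image)

lemma smooth_fun_mult:
  assumes "openin M W" "smooth_fun W f" "smooth_fun W h"
  shows "smooth_fun W (\<lambda>q. f q * h q)"
  using assms smooth_on_scaleR[of _ "f \<circ> chart_inv c" "h \<circ> chart_inv c" for c]
  by (auto simp: smooth_fun_def o_def open_chart_image)

lemma smooth_fun_sum:
  "openin M W \<Longrightarrow> finite I \<Longrightarrow> (\<And>i. i \<in> I \<Longrightarrow> smooth_fun W (f i)) \<Longrightarrow> smooth_fun W (\<lambda>q. \<Sum>i\<in>I. f i q)"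
  by (auto simp: smooth_fun_def o_def intro!: smooth_on_sum open_chart_image)

lemma smooth_fun_minus:
  "openin M W \<Longrightarrow> smooth_fun W f \<Longrightarrow> smooth_fun W (\<lambda>q. - f q)"
  using smooth_fun_mult[of W "\<lambda>q. -1" f] by (simp add: smooth_fun_const)

lemma smooth_fun_diff:
  "openin M W \<Longrightarrow> smooth_fun W f \<Longrightarrow> smooth_fun W h \<Longrightarrow> smooth_fun W (\<lambda>q. f q - h q)"
  using smooth_fun_add[of W f "\<lambda>q. - h q"] by (simp add: smooth_fun_minus)

lemma smooth_fun_divide:
  assumes "openin M W" "smooth_fun W f" "smooth_fun W h" "\<And>q. q \<in> W \<Longrightarrow> h q \<noteq> 0"
  shows "smooth_fun W (\<lambda>q. f q / h q)"
proof -
  have "smooth_fun W (\<lambda>q. inverse (h q))"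
    unfolding smooth_fun_def o_def
  proof
    fix c assume "c \<in> A"
    then show "smooth_on (\<lambda>x. inverse (h (chart_inv c x))) (snd c ` (W \<inter> fst c))"
      using assms by (intro smooth_on_inverse open_chart_image) (auto simp: smooth_fun_def o_def)
  qed
  then show ?thesis using smooth_fun_mult[OF assms(1,2)] by (simp add: divide_inverse)
qed

lemma smooth_field_add:
  assumes "openin M W" "smooth_field W X" "smooth_field W Y"
  shows "smooth_field W (\<lambda>q. X q + Y q)"
  unfolding smooth_field_def
proof
  fix c assume c: "c \<in> A"
  have "smooth_on (\<lambda>x. field_rep c X x + field_rep c Y x) (snd c ` (W \<inter> fst c))"
    using assms c by (intro smooth_on_add open_chart_image) (auto simp: smooth_field_def)
  then show "smooth_on (field_rep c (\<lambda>q. X q + Y q)) (snd c ` (W \<inter> fst c))"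
    by (rule smooth_on_cong[OF open_chart_image[OF c assms(1)], rotated])
      (use c in \<open>auto simp: linear_add[OF linear_components]\<close>)
qed

lemma smooth_field_scaleR:
  assumes "openin M W" "smooth_fun W f" "smooth_field W X"
  shows "smooth_field W (\<lambda>q. f q *\<^sub>R X q)"
  unfolding smooth_field_def
proof
  fix c assume c: "c \<in> A"
  have "smooth_on (\<lambda>x. (f \<circ> chart_inv c) x *\<^sub>R field_rep c X x) (snd c ` (W \<inter> fst c))"
    using assms c
    by (intro smooth_on_scaleR open_chart_image)
      (auto simp: smooth_field_def smooth_fun_def simp del: o_apply)
  then show "smooth_on (field_rep c (\<lambda>q. f q *\<^sub>R X q)) (snd c ` (W \<inter> fst c))"
    by (rule smooth_on_cong[OF open_chart_image[OF c assms(1)], rotated])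
      (use c in \<open>auto simp: linear_cmul[OF linear_components]\<close>)
qed

lemma smooth_field_minus:
  "openin M W \<Longrightarrow> smooth_field W X \<Longrightarrow> smooth_field W (\<lambda>q. - X q)"
  using smooth_field_scaleR[of W "\<lambda>q. -1" X] by (simp add: smooth_fun_const)

lemma smooth_field_diff:
  "openin M W \<Longrightarrow> smooth_field W X \<Longrightarrow> smooth_field W Y \<Longrightarrow> smooth_field W (\<lambda>q. X q - Y q)"
  using smooth_field_add[of W X "\<lambda>q. - Y q"] by (simp add: smooth_field_minus)

lemma smooth_field_sum:
  assumes "openin M W" "finite I" "I \<noteq> {}" "\<And>i. i \<in> I \<Longrightarrow> smooth_field W (X i)"
  shows "smooth_field W (\<lambda>q. \<Sum>i\<in>I. X i q)"
  using assms(2-4) by (induction rule: finite_ne_induct) (auto intro: smooth_field_add[OF assms(1)])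

lemma smooth_field_frame:
  assumes "c \<in> A"
  shows "smooth_field (fst c) (frame c v)"
proof -
  have "smooth_on (field_rep c (frame c v)) (snd c ` fst c)"
    by (rule smooth_on_cong[OF chart_range[OF assms] _ smooth_on_const]) (use assms in auto)
  then show ?thesis using smooth_field_in_chart[OF assms chart_domain[OF assms]] by blast
qed

lemma smooth_fun_components:
  assumes "c \<in> A" "openin M W" "W \<subseteq> fst c" "smooth_field W X"
  shows "smooth_fun W (\<lambda>q. components c q (X q) $ i)"
proof -
  have "smooth_on (\<lambda>x. field_rep c X x $ i) (snd c ` W)"
    using assms smooth_field_in_chart open_chart_image'
    by (intro smooth_on_bounded_linear_comp[OF bounded_linear_vec_nth]) auto
  then have "smooth_on ((\<lambda>q. components c q (X q) $ i) \<circ> chart_inv c) (snd c ` W)"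
    by (rule smooth_on_cong[OF open_chart_image'[OF assms(1-3)], rotated]) (use assms in auto)
  then show ?thesis using smooth_fun_in_chart[OF assms(1-3)] by blast
qed

lemma frame_expansion:
  assumes "c \<in> A" "q \<in> fst c"
  shows "frame c v q = (\<Sum>i\<in>UNIV. v $ i *\<^sub>R frame c (axis i 1) q)"
proof -
  interpret linear "\<lambda>v. frame c v q" by (rule linear_frame[OF assms])
  show ?thesis
    by (subst basis_expansion[of v, symmetric]) (simp only: sum scalar_mult_eq_scaleR scaleR)
qed

lemma field_expansion:
  assumes "c \<in> A" "q \<in> fst c"
  shows "v = (\<Sum>i\<in>UNIV. components c q v $ i *\<^sub>R frame c (axis i 1) q)"
  using frame_expansion[OF assms, of "components c q v"] assms by simp


section \<open>Derivatives along vector fields and the Lie bracket\<close>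

lemma smooth_fun_chart_differentiable:
  assumes "c \<in> A" "openin M W" "q \<in> W" "q \<in> fst c" "smooth_fun W f"
  shows "f \<circ> chart_inv c differentiable at (snd c q)"
  using assms smooth_on_differentiable[of "f \<circ> chart_inv c" "snd c ` (W \<inter> fst c)"]
  by (auto simp: smooth_fun_def)

text \<open>By the chain rule, the derivative along a tangent vector may be computed in any chart, not only in
  the one in which the vector is stored.\<close>

lemma vec_deriv_in_chart:
  assumes "c \<in> A" "openin M W" "q \<in> W" "q \<in> fst c" "smooth_fun W f"
  shows "vec_deriv q v f = frechet_derivative (f \<circ> chart_inv c) (at (snd c q)) (components c q v)"
proof -
  let ?d = "chart_at q"
  note d = chart_at[OF chart_topspace[OF assms(1,4)]]
  have "(f \<circ> chart_inv c has_derivative frechet_derivative (f \<circ> chart_inv c) (at (snd c q)))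
      (at (transition ?d c (snd ?d q)))"
    using smooth_fun_chart_differentiable[OF assms] d by (simp add: frechet_derivative_works)
  from diff_chain_at[OF transition_has_derivative[OF d(1) assms(1) d(2) assms(4)] this]
  have "(f \<circ> chart_inv c \<circ> transition ?d c has_derivative
      frechet_derivative (f \<circ> chart_inv c) (at (snd c q)) \<circ> tangent_change ?d c q) (at (snd ?d q))" .
  moreover have "open (snd ?d ` (fst c \<inter> fst ?d))"
    using d chart_domain[OF assms(1)] by (intro open_chart_image)
  ultimately have "(f \<circ> chart_inv ?d has_derivative
      frechet_derivative (f \<circ> chart_inv c) (at (snd c q)) \<circ> tangent_change ?d c q) (at (snd ?d q))"
    by (rule has_derivative_transform_within_open) (use assms d in auto)
  from frechet_derivative_at[OF this] show ?thesis
    by (simp add: vec_deriv_def components_def fun_eq_iff)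
qed

lemma linear_vec_deriv:
  assumes "openin M W" "q \<in> W" "smooth_fun W f"
  shows "linear (\<lambda>v. vec_deriv q v f)"
  unfolding vec_deriv_def
  using assms smooth_fun_chart_differentiable[OF chart_at(1) assms(1,2) chart_at(2) assms(3)]
    openin_subset[OF assms(1)]
  by (intro linear_frechet_derivative) blast

lemma field_deriv_in_chart:
  assumes "c \<in> A" "openin M W" "q \<in> W" "q \<in> fst c" "smooth_fun W f"
  shows "field_deriv X f q
    = frechet_derivative (f \<circ> chart_inv c) (at (snd c q)) (field_rep c X (snd c q))"
  using vec_deriv_in_chart[OF assms] assms by (simp add: field_deriv_def)

lemma smooth_fun_field_deriv:
  assumes "openin M W" "smooth_fun W f" "smooth_field W X"
  shows "smooth_fun W (field_deriv X f)"
  unfolding smooth_fun_def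
proof
  fix c assume c: "c \<in> A"
  let ?S = "snd c ` (W \<inter> fst c)"
  have S: "open ?S" using open_chart_image[OF c assms(1)] .
  have "smooth_on (\<lambda>x. frechet_derivative (f \<circ> chart_inv c) (at x) (field_rep c X x)) ?S"
    using assms c S by (intro smooth_on_derivative_along) (auto simp: smooth_fun_def smooth_field_def)
  then show "smooth_on (field_deriv X f \<circ> chart_inv c) ?S"
    by (rule smooth_on_cong[OF S, rotated])
      (use assms c in \<open>auto simp: field_deriv_in_chart[where W = W and c = c]\<close>)
qed

lemma field_deriv_cong:
  assumes "openin M W" "q \<in> W" "smooth_fun W f" "\<And>r. r \<in> W \<Longrightarrow> f r = h r"
  shows "field_deriv X f q = field_deriv X h q"
proof -
  let ?c = "chart_at q"
  have q: "q \<in> topspace M" using assms openin_subset by blast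
  note c = chart_at[OF q]
  have "frechet_derivative (f \<circ> chart_inv ?c) (at (snd ?c q))
      = frechet_derivative (h \<circ> chart_inv ?c) (at (snd ?c q))"
    by (rule frechet_derivative_transform_within_open[OF
          smooth_fun_chart_differentiable[OF c(1) assms(1,2) c(2) assms(3)]
          open_chart_image[OF c(1) assms(1)]])
      (use assms c in auto)
  then show ?thesis by (simp add: field_deriv_def vec_deriv_def)
qed

lemma field_deriv_add:
  assumes "openin M W" "q \<in> W" "smooth_fun W f" "smooth_fun W h"
  shows "field_deriv X (\<lambda>r. f r + h r) q = field_deriv X f q + field_deriv X h q"
proof -
  have q: "q \<in> topspace M" using assms openin_subset by blast
  note c = chart_at[OF q]
  have "((\<lambda>x. (f \<circ> chart_inv (chart_at q)) x + (h \<circ> chart_inv (chart_at q)) x) has_derivative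
    (\<lambda>v. frechet_derivative (f \<circ> chart_inv (chart_at q)) (at (snd (chart_at q) q)) v
      + frechet_derivative (h \<circ> chart_inv (chart_at q)) (at (snd (chart_at q) q)) v))
    (at (snd (chart_at q) q))"
    using smooth_fun_chart_differentiable[OF c(1) assms(1,2) c(2)] assms(3,4)
    by (intro has_derivative_add) (auto simp: frechet_derivative_works simp del: o_apply)
  from frechet_derivative_at[OF this, symmetric] show ?thesis
    by (simp add: field_deriv_def vec_deriv_def o_def)
qed

text \<open>The coordinate functions of a chart recover the components of a tangent vector. Hence at most one
  vector meets the description that defines the Lie bracket.\<close>

lemma tangent_vector_eqI:
  assumes "q \<in> topspace M"
    and "\<And>W f. openin M W \<Longrightarrow> q \<in> W \<Longrightarrow> smooth_fun W f \<Longrightarrow> vec_deriv q v f = vec_deriv q w f"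
  shows "v = w"
proof -
  let ?c = "chart_at q"
  note c = chart_at[OF assms(1)]
  have "v $ i = w $ i" for i
  proof -
    let ?f = "\<lambda>r. snd ?c r $ i"
    have "bounded_linear (\<lambda>x::real^3. x $ i)" by (rule bounded_linear_vec_nth)
    then have der: "((\<lambda>x. x $ i) has_derivative (\<lambda>x. x $ i)) (at (snd ?c q))"
      by (rule bounded_linear_imp_has_derivative)
    have "smooth_on (\<lambda>x::real^3. x $ i) (snd ?c ` fst ?c)"
      by (intro smooth_on_bounded_linear_comp[OF bounded_linear_vec_nth] smooth_on_ident chart_range c)
    then have "smooth_on (?f \<circ> chart_inv ?c) (snd ?c ` fst ?c)"
      by (rule smooth_on_cong[OF chart_range[OF c(1)], rotated]) (use c in auto)
    then have sm: "smooth_fun (fst ?c) ?f"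
      using smooth_fun_in_chart[OF c(1) chart_domain[OF c(1)]] by blast
    have "(?f \<circ> chart_inv ?c has_derivative (\<lambda>x. x $ i)) (at (snd ?c q))"
      by (rule has_derivative_transform_within_open[OF der chart_range[OF c(1)]]) (use c in auto)
    from frechet_derivative_at[OF this, symmetric]
    have "vec_deriv q u ?f = u $ i" for u by (simp add: vec_deriv_def)
    with assms(2)[OF chart_domain[OF c(1)] c(2) sm] show ?thesis by simp
  qed
  then show ?thesis by (simp add: vec_eq_iff)
qed

text \<open>The product rule, after expanding the direction \<open>Y\<close> in a basis: one term differentiates \<open>F\<close> twice
  with the direction frozen at \<open>x\<close>, the other differentiates the direction.\<close>

lemma derivative_of_derivative_along:
  fixes F :: "'e::euclidean_space \<Rightarrow> real"
  assumes F: "smooth_on F S" and Y: "smooth_on Y S" and S: "open S" "x \<in> S"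
  shows "frechet_derivative (\<lambda>y. frechet_derivative F (at y) (Y y)) (at x) w
    = frechet_derivative (\<lambda>y. frechet_derivative F (at y) (Y x)) (at x) w
      + frechet_derivative F (at x) (frechet_derivative Y (at x) w)"
proof -
  let ?D = "\<lambda>b y. frechet_derivative F (at y) b"
  have diff: "F differentiable at y" if "y \<in> S" for y
    using smooth_on_differentiable[OF F that] .
  have Dder: "(?D b has_derivative frechet_derivative (?D b) (at x)) (at x)" for b
    using smooth_on_differentiable[OF smooth_on_derivative[OF F] S(2)]
    by (simp add: frechet_derivative_works)
  have Yder: "(Y has_derivative frechet_derivative Y (at x)) (at x)"
    using smooth_on_differentiable[OF Y S(2)] by (simp add: frechet_derivative_works)
  have "((\<lambda>y. \<Sum>b\<in>Basis. (Y y \<bullet> b) *\<^sub>R ?D b y) has_derivative (\<lambda>w. \<Sum>b\<in>Basis.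
      (Y x \<bullet> b) *\<^sub>R frechet_derivative (?D b) (at x) w
      + (frechet_derivative Y (at x) w \<bullet> b) *\<^sub>R ?D b x)) (at x)"
    by (intro has_derivative_sum has_derivative_scaleR Dder has_derivative_inner_left Yder)
  then have "((\<lambda>y. ?D (Y y) y) has_derivative (\<lambda>w. \<Sum>b\<in>Basis.
      (Y x \<bullet> b) *\<^sub>R frechet_derivative (?D b) (at x) w
      + (frechet_derivative Y (at x) w \<bullet> b) *\<^sub>R ?D b x)) (at x)"
    by (rule has_derivative_transform_within_open[OF _ S])
      (metis frechet_derivative_Basis diff)
  note 1 = frechet_derivative_at[OF this, symmetric]
  have "((\<lambda>y. \<Sum>b\<in>Basis. (Y x \<bullet> b) *\<^sub>R ?D b y) has_derivative (\<lambda>w. \<Sum>b\<in>Basis.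
      (Y x \<bullet> b) *\<^sub>R frechet_derivative (?D b) (at x) w)) (at x)"
    by (intro has_derivative_sum has_derivative_scaleR_right Dder)
  then have "((\<lambda>y. ?D (Y x) y) has_derivative (\<lambda>w. \<Sum>b\<in>Basis.
      (Y x \<bullet> b) *\<^sub>R frechet_derivative (?D b) (at x) w)) (at x)"
    by (rule has_derivative_transform_within_open[OF _ S])
      (metis frechet_derivative_Basis diff)
  note 2 = frechet_derivative_at[OF this, symmetric]
  show ?thesis
    unfolding 1 2 sum.distrib frechet_derivative_Basis[OF diff[OF S(2)], symmetric] ..
qed

text \<open>The first summand is a mixed second derivative, hence symmetric in \<open>X\<close> and \<open>Y\<close>; only the second
  survives in a commutator.\<close>

lemma second_field_deriv_in_chart:
  assumes c: "c \<in> A" and U: "openin M U" "U \<subseteq> fst c" "q \<in> U"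
    and f: "smooth_fun U f" and Y: "smooth_field U Y"
  shows "field_deriv X (field_deriv Y f) q
    = frechet_derivative (\<lambda>y. frechet_derivative (f \<circ> chart_inv c) (at y) (components c q (Y q)))
        (at (snd c q)) (components c q (X q))
      + frechet_derivative (f \<circ> chart_inv c) (at (snd c q))
          (frechet_derivative (field_rep c Y) (at (snd c q)) (components c q (X q)))"
proof -
  let ?S = "snd c ` U" and ?F = "f \<circ> chart_inv c"
  have S: "open ?S" "snd c q \<in> ?S" using open_chart_image'[OF c U(1,2)] U(3) by auto
  have q: "q \<in> fst c" using U by blast
  have F: "smooth_on ?F ?S" using f smooth_fun_in_chart[OF c U(1,2)] by blast
  have YS: "smooth_on (field_rep c Y) ?S" using Y smooth_field_in_chart[OF c U(1,2)] by blast
  have "field_deriv X (field_deriv Y f) q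
      = frechet_derivative (field_deriv Y f \<circ> chart_inv c) (at (snd c q)) (components c q (X q))"
    using field_deriv_in_chart[OF c U(1,3) q smooth_fun_field_deriv[OF U(1) f Y]] c q by simp
  also have "frechet_derivative (field_deriv Y f \<circ> chart_inv c) (at (snd c q))
      = frechet_derivative (\<lambda>y. frechet_derivative ?F (at y) (field_rep c Y y)) (at (snd c q))"
  proof (rule frechet_derivative_transform_within_open[OF _ S])
    show "field_deriv Y f \<circ> chart_inv c differentiable at (snd c q)"
      by (rule smooth_fun_chart_differentiable[OF c U(1,3) q smooth_fun_field_deriv[OF U(1) f Y]])
    show "(field_deriv Y f \<circ> chart_inv c) y = frechet_derivative ?F (at y) (field_rep c Y y)"
      if "y \<in> ?S" for y
      using that c U f by (auto simp: field_deriv_in_chart[where W = U and c = c] subset_iff)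
  qed
  finally show ?thesis
    using derivative_of_derivative_along[OF F YS S] c q by simp
qed

text \<open>In coordinates the commutator of two derivations is again a first order operator, because the
  second order terms cancel by the symmetry of mixed derivatives.\<close>

lemma lie_bracket_commutator:
  assumes W: "openin M W" "q \<in> W" and X: "smooth_field W X" and Y: "smooth_field W Y"
    and f: "openin M V" "q \<in> V" "smooth_fun V f"
  shows "vec_deriv q (lie_bracket X Y q) f
    = field_deriv X (field_deriv Y f) q - field_deriv Y (field_deriv X f) q"
proof -
  define c x where "c = chart_at q" and "x = snd c q"
  have q: "q \<in> topspace M" using W openin_subset by blast
  have c: "c \<in> A" "q \<in> fst c" using chart_at[OF q] by (simp_all add: c_def)
  \<comment> \<open>the coordinate formula for the bracket\<close>
  define v where "v = frechet_derivative (field_rep c Y) (at x) (X q)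
    - frechet_derivative (field_rep c X) (at x) (Y q)"
  have v: "vec_deriv q v h = field_deriv X (field_deriv Y h) q - field_deriv Y (field_deriv X h) q"
    if h: "openin M V" "q \<in> V" "smooth_fun V h" for V h
  proof -
    let ?U = "W \<inter> V \<inter> fst c"
    have U: "openin M ?U" "?U \<subseteq> fst c" "q \<in> ?U" using W h c chart_domain[OF c(1)] by auto
    have hU: "smooth_fun ?U h" and XU: "smooth_field ?U X" and YU: "smooth_field ?U Y"
      by (rule smooth_fun_subset[OF h(3)] smooth_field_subset[OF X] smooth_field_subset[OF Y]; blast)+
    have S: "open (snd c ` ?U)" "x \<in> snd c ` ?U"
      using open_chart_image'[OF c(1) U(1,2)] U(3) by (auto simp: x_def)
    have H: "smooth_on (h \<circ> chart_inv c) (snd c ` ?U)"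
      using hU smooth_fun_in_chart[OF c(1) U(1,2)] by blast
    note lin = linear_frechet_derivative[OF smooth_on_differentiable[OF H S(2)]]
    have "vec_deriv q v h = frechet_derivative (h \<circ> chart_inv c) (at x) v"
      using vec_deriv_in_chart[OF c(1) h(1,2) c(2) h(3)] q by (simp add: c_def x_def)
    then show ?thesis
      using second_field_deriv_in_chart[OF c(1) U hU XU, of Y]
        second_field_deriv_in_chart[OF c(1) U hU YU, of X] q
        mixed_derivatives_commute[OF H S, of "X q" "Y q"]
      by (simp add: v_def linear_diff[OF lin] flip: x_def) (simp add: c_def)
  qed
  have "\<forall>V h. openin M V \<and> q \<in> V \<and> smooth_fun V h \<longrightarrow> vec_deriv q (lie_bracket X Y q) h
      = field_deriv X (field_deriv Y h) q - field_deriv Y (field_deriv X h) q"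
    unfolding lie_bracket_def
  proof (rule theI[of _ v])
    show "\<forall>V h. openin M V \<and> q \<in> V \<and> smooth_fun V h \<longrightarrow> vec_deriv q v h
      = field_deriv X (field_deriv Y h) q - field_deriv Y (field_deriv X h) q"
      using v by blast
    fix w assume "\<forall>V h. openin M V \<and> q \<in> V \<and> smooth_fun V h \<longrightarrow> vec_deriv q w h
      = field_deriv X (field_deriv Y h) q - field_deriv Y (field_deriv X h) q"
    then show "w = v" using v by (intro tangent_vector_eqI[OF q]) metis
  qed
  then show ?thesis using f by blast
qed

text \<open>Coordinate vector fields commute: their components in \<open>c\<close> are constant, so only the mixed second
  derivatives remain, and these are symmetric.\<close>

lemma lie_bracket_frame:
  assumes c: "c \<in> A" and q: "q \<in> fst c"
  shows "lie_bracket (frame c v) (frame c w) q = 0"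
proof (rule tangent_vector_eqI)
  show top: "q \<in> topspace M" using chart_topspace assms by blast
  fix V f assume f: "openin M V" "q \<in> V" "smooth_fun V f"
  let ?U = "V \<inter> fst c"
  have U: "openin M ?U" "?U \<subseteq> fst c" "q \<in> ?U" using f q chart_domain[OF c] by auto
  have fU: "smooth_fun ?U f" using smooth_fun_subset[OF f(3)] by blast
  have S: "open (snd c ` ?U)" "snd c q \<in> snd c ` ?U"
    using open_chart_image'[OF c U(1,2)] U(3) by auto
  have F: "smooth_on (f \<circ> chart_inv c) (snd c ` ?U)"
    using fU smooth_fun_in_chart[OF c U(1,2)] by blast
  have const: "frechet_derivative (field_rep c (frame c u)) (at (snd c q)) = (\<lambda>x. 0)" for u
  proof -
    have "((\<lambda>x. u) has_derivative (\<lambda>x. 0)) (at (snd c q))" by simp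
    then have "(field_rep c (frame c u) has_derivative (\<lambda>x. 0)) (at (snd c q))"
      by (rule has_derivative_transform_within_open[OF _ S]) (use c in auto)
    then show ?thesis by (rule frechet_derivative_at[symmetric])
  qed
  have fr: "smooth_field ?U (frame c u)" for u
    using smooth_field_subset[OF smooth_field_frame[OF c]] by blast
  have "field_deriv (frame c v) (field_deriv (frame c w) f) q
      = field_deriv (frame c w) (field_deriv (frame c v) f) q"
    using second_field_deriv_in_chart[OF c U fU fr] const mixed_derivatives_commute[OF F S]
      linear_0[OF linear_frechet_derivative[OF smooth_on_differentiable[OF F S(2)]]] c q
    by simp
  then show "vec_deriv q (lie_bracket (frame c v) (frame c w) q) f = vec_deriv q 0 f"
    using lie_bracket_commutator[OF chart_domain[OF c] q smooth_field_frame[OF c] smooth_field_frame[OF c] f]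
      linear_0[OF linear_vec_deriv[OF f]] by simp
qed

end

section \<open>Linear algebra in a tangent space\<close>

text \<open>Applied both to orthonormal bases and to coordinate frames, with \<open>P\<close> assembling a vector from its
  components and \<open>Q\<close> extracting them.\<close>

lemma trace_conjugate:
  fixes L P Q :: "real^'n \<Rightarrow> real^'n"
  assumes "linear L" "linear P" "linear Q" "\<And>v. P (Q v) = v"
  shows "trace (matrix L) = (\<Sum>i\<in>UNIV. Q (L (P (axis i 1))) $ i)"
proof -
  have "matrix L = matrix P ** matrix (Q \<circ> L)"
    using assms by (subst matrix_compose[symmetric]) (auto intro: linear_compose[unfolded o_def] simp: o_def)
  then have "trace (matrix L) = trace (matrix (Q \<circ> L) ** matrix P)"
    by (simp only: trace_mul_sym[of "matrix P"])
  also have "\<dots> = trace (matrix (Q \<circ> L \<circ> P))"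
    using assms by (simp add: matrix_compose linear_compose)
  finally show ?thesis by (simp add: trace_def matrix_def)
qed

context oriented_riemannian_3manifold
begin

lemma linear_metric:
  assumes "p \<in> topspace M"
  shows "linear (g p v)" and "linear (\<lambda>v. g p v w)"
  using metric_bilinear[OF assms] by (auto simp: bilinear_def)

lemma metric_add:
  assumes "p \<in> topspace M"
  shows "g p (u + v) w = g p u w + g p v w" "g p u (v + w) = g p u v + g p u w"
  using linear_add[OF linear_metric(2)[OF assms]] linear_add[OF linear_metric(1)[OF assms]] by auto

lemma metric_diff:
  assumes "p \<in> topspace M"
  shows "g p (u - v) w = g p u w - g p v w" "g p u (v - w) = g p u v - g p u w"
  using linear_diff[OF linear_metric(2)[OF assms]] linear_diff[OF linear_metric(1)[OF assms]] by auto

lemma metric_minus: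
  assumes "p \<in> topspace M"
  shows "g p (- u) w = - g p u w" "g p u (- w) = - g p u w"
  using linear_neg[OF linear_metric(2)[OF assms]] linear_neg[OF linear_metric(1)[OF assms]] by auto

lemma metric_scale:
  assumes "p \<in> topspace M"
  shows "g p (k *\<^sub>R v) w = k * g p v w" "g p v (k *\<^sub>R w) = k * g p v w"
  using linear_cmul[OF linear_metric(2)[OF assms]] linear_cmul[OF linear_metric(1)[OF assms]] by auto

lemma metric_sum_left:
  assumes "p \<in> topspace M"
  shows "g p (\<Sum>i\<in>I. v i) w = (\<Sum>i\<in>I. g p (v i) w)"
  using linear_sum[OF linear_metric(2)[OF assms]] .

lemma metric_nondegenerate:
  assumes "p \<in> topspace M" "\<And>w. g p u w = g p v w"
  shows "u = v"
  using metric_pos[OF assms(1), of "u - v"] assms(2)[of "u - v"]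
  by (fastforce simp: metric_diff[OF assms(1)])

text \<open>Riesz representation: pairing with the standard basis gives an injective, hence surjective, linear
  map of the three-dimensional tangent space.\<close>

lemma metric_sharp:
  assumes p: "p \<in> topspace M" and "linear \<alpha>"
  shows "g p (sharp p \<alpha>) v = \<alpha> v"
proof -
  let ?L = "\<lambda>w. (\<chi> i. g p w (axis i 1)) :: real^3"
  have eq: "g p w = h" if "linear h" "\<And>i. g p w (axis i 1) = h (axis i 1)" for w h
  proof (rule linear_eq_stdbasis[OF linear_metric(1)[OF p] that(1)])
    fix b :: "real^3" assume "b \<in> Basis"
    then show "g p w b = h b" using that(2) by (auto simp: Basis_vec_def)
  qed
  have lin: "linear ?L"
    by (rule linearI) (auto simp: vec_eq_iff metric_add[OF p] metric_scale[OF p])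
  have "inj ?L"
  proof (rule injI)
    fix u v assume "?L u = ?L v"
    then have "g p u = g p v" by (intro eq linear_metric p) (simp add: vec_eq_iff)
    then show "u = v" by (intro metric_nondegenerate[OF p]) simp
  qed
  from surjD[OF linear_injective_imp_surjective[OF lin this], of "\<chi> i. \<alpha> (axis i 1)"]
  obtain w where "?L w = (\<chi> i. \<alpha> (axis i 1))" by auto
  then have w: "g p w = \<alpha>" by (intro eq assms(2)) (simp add: vec_eq_iff)
  have "\<forall>v. g p (sharp p \<alpha>) v = \<alpha> v"
    unfolding sharp_def
    by (rule theI[of _ w]) (use w in \<open>auto intro: metric_nondegenerate[OF p]\<close>)
  then show ?thesis by blast
qed

lemma sharp_eqI:
  assumes "p \<in> topspace M" "\<And>v. g p w v = \<alpha> v"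
  shows "sharp p \<alpha> = w"
  unfolding sharp_def
  by (rule the_equality) (use assms in \<open>auto intro: metric_nondegenerate[OF assms(1)]\<close>)

lemma metric_endo_of_form:
  assumes "p \<in> topspace M" "bilinear B"
  shows "g p (endo_of_form p B v) w = B v w"
  unfolding endo_of_form_def using assms by (intro metric_sharp) (auto simp: bilinear_def)

lemma linear_endo_of_form:
  assumes p: "p \<in> topspace M" and B: "bilinear B"
  shows "linear (endo_of_form p B)"
  by (rule linearI; rule metric_nondegenerate[OF p])
    (simp_all add: metric_endo_of_form[OF p B] metric_add[OF p] metric_scale[OF p]
      bilinear_ladd[OF B] bilinear_lmul[OF B])

definition orthonormal_sum :: "real^3^3 \<Rightarrow> real^3 \<Rightarrow> real^3" where
  "orthonormal_sum S k = (\<Sum>i\<in>UNIV. k $ i *\<^sub>R S $ i)"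

definition orthonormal_coeffs :: "'a \<Rightarrow> real^3^3 \<Rightarrow> real^3 \<Rightarrow> real^3" where
  "orthonormal_coeffs p S v = (\<chi> i. g p v (S $ i))"

lemma linear_orthonormal_sum: "linear (orthonormal_sum S)"
  by (rule linearI)
    (simp_all add: orthonormal_sum_def scaleR_add_left sum.distrib scaleR_sum_right)

lemma linear_orthonormal_coeffs: "p \<in> topspace M \<Longrightarrow> linear (orthonormal_coeffs p S)"
  by (rule linearI) (simp_all add: orthonormal_coeffs_def vec_eq_iff metric_add metric_scale)

lemma orthonormal_sum_axis [simp]: "orthonormal_sum S (axis i 1) = S $ i"
  unfolding orthonormal_sum_def axis_def
  by (simp add: if_distrib[of "\<lambda>x. x *\<^sub>R _"] sum.delta cong: if_cong)

lemma coeffs_orthonormal_sum: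
  assumes p: "p \<in> topspace M"
    and "\<And>i j. g p (S $ i) (S $ j) = (if i = j then 1 else 0)"
  shows "orthonormal_coeffs p S (orthonormal_sum S k) = k"
  by (simp add: orthonormal_coeffs_def orthonormal_sum_def vec_eq_iff metric_sum_left[OF p]
      metric_scale[OF p] assms(2) if_distrib[of "\<lambda>x. _ * x"] cong: if_cong)

lemma orthonormal_sum_coeffs:
  assumes p: "p \<in> topspace M"
    and S: "\<And>i j. g p (S $ i) (S $ j) = (if i = j then 1 else 0)"
  shows "orthonormal_sum S (orthonormal_coeffs p S v) = v"
proof -
  have "inj (orthonormal_sum S)"
    using coeffs_orthonormal_sum[OF assms] by (metis injI)
  then obtain k where "v = orthonormal_sum S k"
    using linear_injective_imp_surjective[OF linear_orthonormal_sum] by (metis surjD)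
  then show ?thesis using coeffs_orthonormal_sum[OF assms] by simp
qed

text \<open>Successive orthogonal complements in dimension three; since the dimension is odd, \<open>-S\<close> has
  the opposite orientation to \<open>S\<close>.\<close>

lemma oriented_orthonormal_exists:
  assumes p: "p \<in> topspace M"
  obtains S where "oriented_orthonormal p S"
proof -
  let ?L = "\<lambda>w. (\<chi> i. g p w (axis i 1)) :: real^3"
  have L: "g p w v = ?L w \<bullet> v" for w v
  proof -
    have "g p w v = g p w (\<Sum>i\<in>UNIV. v $ i *\<^sub>R axis i 1)"
      by (simp add: basis_expansion flip: scalar_mult_eq_scaleR)
    also have "\<dots> = (\<Sum>i\<in>UNIV. v $ i * g p w (axis i 1))"
      by (simp add: linear_sum[OF linear_metric(1)[OF p]] metric_scale[OF p])
    finally show ?thesis by (simp add: inner_vec_def mult.commute)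
  qed
  have perp: "\<exists>x. x \<noteq> 0 \<and> g p u x = 0 \<and> g p v x = 0" for u v
  proof -
    have "dim {?L u, ?L v} \<le> card {?L u, ?L v}" by (rule dim_le_card') simp
    also have "\<dots> < DIM(real^3)" using card_insert_le_m1[of 2 "{?L v}" "?L u"] by simp
    finally obtain x where "x \<noteq> 0" "\<And>y. y \<in> span {?L u, ?L v} \<Longrightarrow> orthogonal x y"
      using orthogonal_to_subspace_exists by blast
    then show ?thesis
      by (metis L inner_commute insertI1 insertI2 orthogonal_def singletonI span_base)
  qed
  define n where "n v = (1 / sqrt (g p v v)) *\<^sub>R v" for v
  have n: "g p (n v) (n v) = 1" if "v \<noteq> 0" for v
    using metric_pos[OF p that] by (simp add: n_def metric_scale[OF p])
  obtain a :: "real^3" where a: "a \<noteq> 0" using perp by blast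
  obtain b where b: "b \<noteq> 0" "g p a b = 0" using perp by blast
  obtain c where c: "c \<noteq> 0" "g p a c = 0" "g p b c = 0" using perp by blast
  define S :: "real^3^3" where "S = vector [n a, n b, n c]"
  have orth: "g p (n u) (n v) = 0" "g p (n v) (n u) = 0" if "g p u v = 0" for u v
    using that metric_sym[OF p, of v u] by (simp_all add: n_def metric_scale[OF p])
  have S: "g p (S $ i) (S $ j) = (if i = j then 1 else 0)" for i j
    using exhaust_3[of i] exhaust_3[of j] n a b c orth by (auto simp: S_def)
  have "det S \<noteq> 0"
  proof -
    have "orthonormal_sum S = (*v) (transpose S)"
      by (simp add: fun_eq_iff orthonormal_sum_def matrix_vector_mult_def transpose_def vec_eq_iff
          mult.commute)
    then have "inj ((*v) (transpose S))"
      using coeffs_orthonormal_sum[OF p S] by (metis injI)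
    then have "det (matrix ((*v) (transpose S))) \<noteq> 0"
      using det_nz_iff_inj[OF matrix_vector_mul_linear] by blast
    then show ?thesis by (simp only: matrix_of_matrix_vector_mul det_transpose not_False_eq_True)
  qed
  then have "oriented_orthonormal p S \<or> oriented_orthonormal p (- S)"
    using S by (auto simp: oriented_orthonormal_def metric_minus[OF p] det_3)
  then show thesis using that by blast
qed

lemma trace_orthonormal:
  assumes p: "p \<in> topspace M" and S: "oriented_orthonormal p S" and "linear L"
  shows "trace (matrix L) = (\<Sum>i\<in>UNIV. g p (L (S $ i)) (S $ i))"
  using trace_conjugate[OF assms(3) linear_orthonormal_sum linear_orthonormal_coeffs[OF p],
      of S S] orthonormal_sum_coeffs[OF p, of S] S
  by (simp add: oriented_orthonormal_def orthonormal_coeffs_def)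

text \<open>In dimension three an alternating form is a linear function of the cross product, and rotations
  preserve the cross product; so the star does not depend on the oriented orthonormal frame.\<close>

lemma hodge_star:
  assumes p: "p \<in> topspace M" and \<omega>: "bilinear \<omega>" and alt: "\<And>v w. \<omega> v w = - \<omega> w v"
  shows "linear (hodge_star p \<omega>) \<and> (\<forall>S. oriented_orthonormal p S \<longrightarrow>
     hodge_star p \<omega> (S $ 1) = \<omega> (S $ 2) (S $ 3) \<and>
     hodge_star p \<omega> (S $ 2) = \<omega> (S $ 3) (S $ 1) \<and>
     hodge_star p \<omega> (S $ 3) = \<omega> (S $ 1) (S $ 2))"
    (is "?P (hodge_star p \<omega>)")
proof -
  obtain S where S: "oriented_orthonormal p S" using oriented_orthonormal_exists[OF p] .
  then have ON: "g p (S $ i) (S $ j) = (if i = j then 1 else 0)" for i j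
    by (simp add: oriented_orthonormal_def)
  let ?B = "orthonormal_sum S" and ?Q = "orthonormal_coeffs p S"
  \<comment> \<open>\<open>\<omega>\<close> as a function of the cross product of the coefficients with respect to \<open>S\<close>\<close>
  define \<Omega> where "\<Omega> k = k $ 1 *\<^sub>R \<omega> (S $ 2) (S $ 3) + k $ 2 *\<^sub>R \<omega> (S $ 3) (S $ 1)
    + k $ 3 *\<^sub>R \<omega> (S $ 1) (S $ 2)" for k :: "real^3"
  have lin\<Omega>: "linear \<Omega>" by (rule linearI) (simp_all add: \<Omega>_def algebra_simps)
  have self: "\<omega> v v = 0" for v using alt[of v v] by (simp add: vec_eq_iff)
  have cross: "\<omega> (?B a) (?B b) = \<Omega> (cross3 a b)" for a b
    unfolding orthonormal_sum_def sum_3 bilinear_ladd[OF \<omega>] bilinear_radd[OF \<omega>]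
      bilinear_lmul[OF \<omega>] bilinear_rmul[OF \<omega>] self
      alt[of "S $ 2" "S $ 1"] alt[of "S $ 3" "S $ 2"] alt[of "S $ 1" "S $ 3"]
    by (simp add: \<Omega>_def cross_components algebra_simps)
  have lin: "linear (\<Omega> \<circ> ?Q)"
    by (intro linear_compose linear_orthonormal_coeffs p lin\<Omega>)
  have star: "(\<Omega> \<circ> ?Q) (T $ i) = \<omega> (T $ j) (T $ k)"
    if T: "oriented_orthonormal p T" and ax: "cross3 (axis j 1) (axis k 1) = (axis i 1 :: real^3)" for T i j k
  proof -
    \<comment> \<open>the rotation that takes the frame \<open>S\<close> to the frame \<open>T\<close>\<close>
    define R where "R = (\<chi> i. ?Q (T $ i))"
    have row: "?B (R $ i) = T $ i" for i
      by (simp add: R_def orthonormal_sum_coeffs[OF p ON])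
    have TON: "g p (T $ i) (T $ j) = (if i = j then 1 else 0)" for i j
      using T by (simp add: oriented_orthonormal_def)
    have "R $ i \<bullet> R $ j = g p (?B (R $ i)) (T $ j)" for i j
      by (simp add: R_def orthonormal_sum_def metric_sum_left[OF p] metric_scale[OF p]
          inner_vec_def orthonormal_coeffs_def metric_sym[OF p, of "T $ j"])
    then have "R ** transpose R = mat 1"
      by (simp add: row TON matrix_matrix_mult_def transpose_def mat_def inner_vec_def vec_eq_iff)
    then have orth: "orthogonal_matrix R"
      by (simp add: orthogonal_matrix_def matrix_left_right_inverse)
    have "T = R ** S"
      by (subst vec_eq_iff) (simp flip: row add: orthonormal_sum_def matrix_matrix_mult_def vec_eq_iff)
    then have "det T = det R * det S" by (simp add: det_mul)
    then have "det R > 0"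
      using S T by (auto simp: oriented_orthonormal_def zero_less_mult_iff)
    then have rot: "rotation_matrix (transpose R)"
      using orth det_orthogonal_matrix[OF orth] by (auto simp: rotation_matrix_def orthogonal_matrix_transpose)
    have tr: "transpose R *v axis i 1 = R $ i" for i
      by (simp add: matrix_vector_mult_basis column_def transpose_def vec_eq_iff)
    have "cross3 (R $ j) (R $ k) = R $ i"
      using cross_rotation_matrix[OF rot, of "axis j 1" "axis k 1"] by (simp only: tr ax)
    then have "\<Omega> (R $ i) = \<omega> (?B (R $ j)) (?B (R $ k))" by (simp add: cross)
    then show ?thesis by (simp add: row) (simp add: R_def)
  qed
  have ex: "?P (\<Omega> \<circ> ?Q)"
    by (intro conjI allI impI lin star) (simp_all add: cross_basis)
  have unique: "\<alpha> = \<beta>" if "?P \<alpha>" "?P \<beta>" for \<alpha> \<beta>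
  proof
    fix v
    have "\<alpha> (S $ i) = \<beta> (S $ i)" for i using that S exhaust_3[of i] by metis
    then have "\<alpha> (?B k) = \<beta> (?B k)" for k
      using that by (simp add: orthonormal_sum_def linear_sum linear_cmul)
    then show "\<alpha> v = \<beta> v" by (metis orthonormal_sum_coeffs[OF p ON])
  qed
  show ?thesis
    unfolding hodge_star_def by (rule theI[of ?P, OF ex unique[OF _ ex]])
qed

end

section \<open>Tensoriality of the curvature\<close>

context smooth_3manifold
begin

text \<open>Expanding in a frame: an expression that is additive, local and linear over functions in a
  vector field depends only on the value of that field at the point.\<close>

lemma tensorial_pointwise:
  fixes T :: "('a \<Rightarrow> real^3) \<Rightarrow> 'v::real_vector"
  assumes c: "c \<in> A" and W: "openin M W" "W \<subseteq> fst c" "p \<in> W"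
    and add: "\<And>X Y. smooth_field W X \<Longrightarrow> smooth_field W Y \<Longrightarrow> T (\<lambda>q. X q + Y q) = T X + T Y"
    and scale: "\<And>f X. smooth_fun W f \<Longrightarrow> smooth_field W X \<Longrightarrow> T (\<lambda>q. f q *\<^sub>R X q) = f p *\<^sub>R T X"
    and cong: "\<And>X Y. smooth_field W X \<Longrightarrow> (\<And>q. q \<in> W \<Longrightarrow> X q = Y q) \<Longrightarrow> T X = T Y"
    and X: "smooth_field W X" and Y: "smooth_field W Y" and eq: "X p = Y p"
  shows "T X = T Y"
proof -
  have E: "smooth_field W (frame c v)" for v
    using smooth_field_subset[OF smooth_field_frame[OF c] W(2)] .
  have expand: "T Z = (\<Sum>i\<in>UNIV. components c p (Z p) $ i *\<^sub>R T (frame c (axis i 1)))"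
    if Z: "smooth_field W Z" for Z
  proof -
    let ?t = "\<lambda>i q. components c q (Z q) $ i *\<^sub>R frame c (axis i 1) q"
    have t: "smooth_field W (?t i)" for i
      by (intro smooth_field_scaleR W(1) smooth_fun_components[OF c W(1,2) Z] E)
    have "T Z = T (\<lambda>q. ?t 1 q + ?t 2 q + ?t 3 q)"
      using field_expansion[OF c] W(2) by (intro cong Z) (auto simp: sum_3)
    also have "\<dots> = T (?t 1) + T (?t 2) + T (?t 3)"
      by (simp add: add t smooth_field_add[OF W(1)])
    also have "\<dots> = (\<Sum>i\<in>UNIV. components c p (Z p) $ i *\<^sub>R T (frame c (axis i 1)))"
      by (simp add: sum_3 scale smooth_fun_components[OF c W(1,2) Z] E)
    finally show ?thesis .
  qed
  show ?thesis by (simp add: expand X Y eq)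
qed

end

context levi_civita_3manifold
begin

text \<open>The indicator of \<open>W\<close> is smooth on \<open>W\<close>, so the Leibniz rule forces locality.\<close>

lemma nabla_cong_right:
  assumes "openin M W" "smooth_field W X" "smooth_field W Y" "\<And>q. q \<in> W \<Longrightarrow> Y q = Y' q" "p \<in> W"
  shows "\<nabla> X Y p = \<nabla> X Y' p"
proof -
  let ?f = "\<lambda>q. if q \<in> W then 1 else 0 :: real"
  have f: "smooth_fun W ?f"
    by (rule smooth_fun_cong[OF assms(1) smooth_fun_const[of W 1]]) simp
  have Y': "smooth_field W Y'" by (rule smooth_field_cong[OF assms(1,3,4)])
  have "(\<lambda>q. ?f q *\<^sub>R Y q) = (\<lambda>q. ?f q *\<^sub>R Y' q)" using assms(4) by auto
  then show ?thesis
    using nabla_Leibniz[OF assms(1) f assms(2,3,5)] nabla_Leibniz[OF assms(1) f assms(2) Y' assms(5)]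
      assms(4,5) by simp
qed

lemma nabla_cong_left:
  assumes "openin M W" "smooth_field W X" "smooth_field W Y" "\<And>q. q \<in> W \<Longrightarrow> X q = X' q" "p \<in> W"
  shows "\<nabla> X Y p = \<nabla> X' Y p"
proof -
  let ?f = "\<lambda>q. if q \<in> W then 1 else 0 :: real"
  have f: "smooth_fun W ?f"
    by (rule smooth_fun_cong[OF assms(1) smooth_fun_const[of W 1]]) simp
  have X': "smooth_field W X'" by (rule smooth_field_cong[OF assms(1,2,4)])
  have "(\<lambda>q. ?f q *\<^sub>R X q) = (\<lambda>q. ?f q *\<^sub>R X' q)" using assms(4) by auto
  then show ?thesis
    using nabla_scale_left[OF assms(1) f assms(2,3,5)] nabla_scale_left[OF assms(1) f X' assms(3,5)]
      assms(5) by simp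
qed

lemma nabla_const_left:
  assumes "openin M W" "smooth_field W X" "smooth_field W Y" "p \<in> W"
  shows "\<nabla> (\<lambda>q. k *\<^sub>R X q) Y p = k *\<^sub>R \<nabla> X Y p"
  using nabla_scale_left[OF assms(1) smooth_fun_const assms(2-4)] .

lemma nabla_const_right:
  assumes "openin M W" "smooth_field W X" "smooth_field W Y" "p \<in> W"
  shows "\<nabla> X (\<lambda>q. k *\<^sub>R Y q) p = k *\<^sub>R \<nabla> X Y p"
  using nabla_Leibniz[OF assms(1) smooth_fun_const assms(2-4)]
  by (simp add: field_deriv_def vec_deriv_def o_def)

lemma nabla_diff_left:
  assumes "openin M W" "smooth_field W X" "smooth_field W X'" "smooth_field W Y" "p \<in> W"
  shows "\<nabla> (\<lambda>q. X q - X' q) Y p = \<nabla> X Y p - \<nabla> X' Y p"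
  using nabla_add_left[OF assms(1,2) smooth_field_minus[OF assms(1,3)] assms(4,5)]
    nabla_const_left[OF assms(1,3-5), of "-1"] by simp

lemma nabla_zero_left:
  assumes "openin M W" "smooth_field W Y" "p \<in> W"
  shows "\<nabla> (\<lambda>q. 0) Y p = 0"
  using nabla_const_left[OF assms(1,2,2,3), of 0] by simp

lemma lie_bracket_torsion:
  "openin M W \<Longrightarrow> smooth_field W X \<Longrightarrow> smooth_field W Y \<Longrightarrow> p \<in> W \<Longrightarrow>
    lie_bracket X Y p = \<nabla> X Y p - \<nabla> Y X p"
  by (simp add: nabla_torsion_free)

lemma smooth_field_lie_bracket:
  assumes "openin M W" "smooth_field W X" "smooth_field W Y"
  shows "smooth_field W (lie_bracket X Y)"
  by (rule smooth_field_cong[OF assms(1) smooth_field_diff[OF assms(1)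
        nabla_smooth[OF assms] nabla_smooth[OF assms(1,3,2)]]])
    (simp add: lie_bracket_torsion[OF assms])

lemma smooth_field_curvature_op:
  assumes "openin M W" "smooth_field W X" "smooth_field W Y" "smooth_field W Z"
  shows "smooth_field W (curvature_op X Y Z)"
  unfolding curvature_op_def[abs_def]
  using assms by (intro smooth_field_diff nabla_smooth smooth_field_lie_bracket) auto

lemma curvature_op_skew_left:
  assumes "openin M W" "smooth_field W X" "smooth_field W Y" "smooth_field W Z" "p \<in> W"
  shows "curvature_op X Y Z p = - curvature_op Y X Z p"
proof -
  have "\<nabla> (lie_bracket X Y) Z p = \<nabla> (\<lambda>q. (-1) *\<^sub>R lie_bracket Y X q) Z p"
    using assms by (intro nabla_cong_left[of W] smooth_field_lie_bracket)
      (auto simp: lie_bracket_torsion[of W])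
  also have "\<dots> = - \<nabla> (lie_bracket Y X) Z p"
    using nabla_const_left[OF assms(1) smooth_field_lie_bracket[OF assms(1,3,2)] assms(4,5), of "-1"]
    by simp
  finally show ?thesis by (simp add: curvature_op_def)
qed

lemma curvature_op_add_left:
  assumes W: "openin M W" and X: "smooth_field W X" and X': "smooth_field W X'"
    and Y: "smooth_field W Y" and Z: "smooth_field W Z" and p: "p \<in> W"
  shows "curvature_op (\<lambda>q. X q + X' q) Y Z p = curvature_op X Y Z p + curvature_op X' Y Z p"
proof -
  note S = smooth_field_add[OF W X X']
  have "\<nabla> Y (\<nabla> (\<lambda>q. X q + X' q) Z) p = \<nabla> Y (\<lambda>q. \<nabla> X Z q + \<nabla> X' Z q) p"
    by (rule nabla_cong_right[OF W Y nabla_smooth[OF W S Z] nabla_add_left[OF W X X' Z] p])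
  also have "\<dots> = \<nabla> Y (\<nabla> X Z) p + \<nabla> Y (\<nabla> X' Z) p"
    using assms by (intro nabla_add_right[of W] nabla_smooth)
  finally have 1: "\<nabla> Y (\<nabla> (\<lambda>q. X q + X' q) Z) p = \<nabla> Y (\<nabla> X Z) p + \<nabla> Y (\<nabla> X' Z) p" .
  have "\<nabla> (lie_bracket (\<lambda>q. X q + X' q) Y) Z p = \<nabla> (\<lambda>q. lie_bracket X Y q + lie_bracket X' Y q) Z p"
    by (rule nabla_cong_left[OF W smooth_field_lie_bracket[OF W S Y] Z _ p])
      (simp add: lie_bracket_torsion[OF W] S X X' Y nabla_add_left[OF W X X'] nabla_add_right[OF W Y X X'])
  also have "\<dots> = \<nabla> (lie_bracket X Y) Z p + \<nabla> (lie_bracket X' Y) Z p"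
    using assms by (intro nabla_add_left[of W] smooth_field_lie_bracket)
  finally show ?thesis
    using nabla_add_left[OF W X X' nabla_smooth[OF W Y Z] p] 1 by (simp add: curvature_op_def)
qed

text \<open>The derivatives of \<open>f\<close> produced by the Leibniz rule and by the bracket cancel.\<close>

lemma curvature_op_scale_left:
  assumes W: "openin M W" and f: "smooth_fun W f" and X: "smooth_field W X"
    and Y: "smooth_field W Y" and Z: "smooth_field W Z" and p: "p \<in> W"
  shows "curvature_op (\<lambda>q. f q *\<^sub>R X q) Y Z p = f p *\<^sub>R curvature_op X Y Z p"
proof -
  note S = smooth_field_scaleR[OF W f X]
  note Yf = smooth_fun_field_deriv[OF W f Y]
  have "\<nabla> Y (\<nabla> (\<lambda>q. f q *\<^sub>R X q) Z) p = \<nabla> Y (\<lambda>q. f q *\<^sub>R \<nabla> X Z q) p"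
    by (rule nabla_cong_right[OF W Y nabla_smooth[OF W S Z] nabla_scale_left[OF W f X Z] p])
  also have "\<dots> = field_deriv Y f p *\<^sub>R \<nabla> X Z p + f p *\<^sub>R \<nabla> Y (\<nabla> X Z) p"
    using nabla_Leibniz[OF W f Y nabla_smooth[OF W X Z] p] .
  finally have 1: "\<nabla> Y (\<nabla> (\<lambda>q. f q *\<^sub>R X q) Z) p
    = field_deriv Y f p *\<^sub>R \<nabla> X Z p + f p *\<^sub>R \<nabla> Y (\<nabla> X Z) p" .
  have "\<nabla> (lie_bracket (\<lambda>q. f q *\<^sub>R X q) Y) Z p
      = \<nabla> (\<lambda>q. f q *\<^sub>R lie_bracket X Y q - field_deriv Y f q *\<^sub>R X q) Z p"
    by (rule nabla_cong_left[OF W smooth_field_lie_bracket[OF W S Y] Z _ p])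
      (simp add: lie_bracket_torsion[OF W] S X Y nabla_scale_left[OF W f X Y]
        nabla_Leibniz[OF W f Y X] scaleR_diff_right)
  also have "\<dots> = f p *\<^sub>R \<nabla> (lie_bracket X Y) Z p - field_deriv Y f p *\<^sub>R \<nabla> X Z p"
    using smooth_field_lie_bracket[OF W X Y]
    by (simp add: nabla_diff_left[OF W _ _ Z p] nabla_scale_left[OF W _ _ Z p]
        smooth_field_scaleR[OF W] f X Yf)
  finally show ?thesis
    using nabla_scale_left[OF W f X nabla_smooth[OF W Y Z] p] 1
    by (simp add: curvature_op_def scaleR_diff_right)
qed

lemma curvature_op_cong_left:
  assumes W: "openin M W" and X: "smooth_field W X" and Y: "smooth_field W Y" and Z: "smooth_field W Z"
    and eq: "\<And>q. q \<in> W \<Longrightarrow> X q = X' q" and p: "p \<in> W"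
  shows "curvature_op X Y Z p = curvature_op X' Y Z p"
proof -
  note X' = smooth_field_cong[OF W X eq]
  have "\<nabla> Y (\<nabla> X Z) p = \<nabla> Y (\<nabla> X' Z) p"
    by (rule nabla_cong_right[OF W Y nabla_smooth[OF W X Z] nabla_cong_left[OF W X Z eq] p])
  moreover have "\<nabla> (lie_bracket X Y) Z p = \<nabla> (lie_bracket X' Y) Z p"
    by (rule nabla_cong_left[OF W smooth_field_lie_bracket[OF W X Y] Z _ p])
      (simp add: lie_bracket_torsion[OF W] X X' Y nabla_cong_left[OF W X Y eq]
        nabla_cong_right[OF W Y X eq])
  ultimately show ?thesis
    using nabla_cong_left[OF W X nabla_smooth[OF W Y Z] eq p] by (simp add: curvature_op_def)
qed

text \<open>Metric compatibility turns the commutator of two derivatives of \<open>g(Z, V)\<close> into the two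
  curvature terms.\<close>

lemma curvature_op_skew_right:
  assumes W: "openin M W" and X: "smooth_field W X" and Y: "smooth_field W Y"
    and Z: "smooth_field W Z" and V: "smooth_field W V" and p: "p \<in> W"
  shows "g p (curvature_op X Y Z p) (V p) = - g p (Z p) (curvature_op X Y V p)"
proof -
  let ?\<phi> = "\<lambda>q. g q (Z q) (V q)"
  have top: "p \<in> topspace M" using W p openin_subset by blast
  have second: "field_deriv X' (field_deriv Y' ?\<phi>) p
    = g p (\<nabla> X' (\<nabla> Y' Z) p) (V p) + g p (\<nabla> Y' Z p) (\<nabla> X' V p)
      + (g p (\<nabla> X' Z p) (\<nabla> Y' V p) + g p (Z p) (\<nabla> X' (\<nabla> Y' V) p))"
    if X': "smooth_field W X'" and Y': "smooth_field W Y'" for X' Y'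
  proof -
    have sm: "smooth_fun W (\<lambda>q. g q (\<nabla> Y' Z q) (V q))" "smooth_fun W (\<lambda>q. g q (Z q) (\<nabla> Y' V q))"
      by (intro metric_smooth nabla_smooth W Y' Z V)+
    have "field_deriv X' (field_deriv Y' ?\<phi>) p
      = field_deriv X' (\<lambda>q. g q (\<nabla> Y' Z q) (V q) + g q (Z q) (\<nabla> Y' V q)) p"
      by (rule field_deriv_cong[OF W p smooth_fun_field_deriv[OF W metric_smooth[OF W Z V] Y']
            nabla_metric[OF W Y' Z V]])
    also have "\<dots> = field_deriv X' (\<lambda>q. g q (\<nabla> Y' Z q) (V q)) p
        + field_deriv X' (\<lambda>q. g q (Z q) (\<nabla> Y' V q)) p"
      by (rule field_deriv_add[OF W p sm])
    finally show ?thesis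
      using nabla_metric[OF W X' nabla_smooth[OF W Y' Z] V p]
        nabla_metric[OF W X' Z nabla_smooth[OF W Y' V] p] by simp
  qed
  have "field_deriv (lie_bracket X Y) ?\<phi> p
      = field_deriv X (field_deriv Y ?\<phi>) p - field_deriv Y (field_deriv X ?\<phi>) p"
    using lie_bracket_commutator[OF W p X Y W p metric_smooth[OF W Z V]]
    by (simp add: field_deriv_def)
  then show ?thesis
    using second[OF X Y] second[OF Y X] nabla_metric[OF W smooth_field_lie_bracket[OF W X Y] Z V p]
    by (simp add: curvature_op_def metric_diff[OF top])
qed

text \<open>In the first two arguments this is the Leibniz computation above; in the third, skew symmetry turns
  the dependence on \<open>Z\<close> into an algebraic pairing with the value \<open>Z p\<close>.\<close>

lemma curvature_op_pointwise:
  assumes c: "c \<in> A" and W: "openin M W" "W \<subseteq> fst c" "p \<in> W"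
    and X: "smooth_field W X" "smooth_field W X'" "X p = X' p"
    and Y: "smooth_field W Y" "smooth_field W Y'" "Y p = Y' p"
    and Z: "smooth_field W Z" "smooth_field W Z'" "Z p = Z' p"
  shows "curvature_op X Y Z p = curvature_op X' Y' Z' p"
proof -
  have left: "curvature_op U V Z p = curvature_op U' V Z p"
    if "smooth_field W U" "smooth_field W U'" "U p = U' p" "smooth_field W V" for U U' V
    by (rule tensorial_pointwise[OF c W, where T = "\<lambda>U. curvature_op U V Z p"])
      (use that Z W in \<open>auto intro: curvature_op_add_left curvature_op_scale_left curvature_op_cong_left\<close>)
  have "curvature_op X Y Z p = curvature_op X' Y Z p"
    by (rule left[OF X Y(1)])
  also have "\<dots> = - curvature_op Y X' Z p"
    by (rule curvature_op_skew_left[OF W(1) X(2) Y(1) Z(1) W(3)])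
  also have "\<dots> = - curvature_op Y' X' Z p"
    by (simp add: left[OF Y X(2)])
  also have "\<dots> = curvature_op X' Y' Z p"
    by (simp add: curvature_op_skew_left[OF W(1) X(2) Y(2) Z(1) W(3)])
  also have "\<dots> = curvature_op X' Y' Z' p"
  proof (rule metric_nondegenerate)
    show top: "p \<in> topspace M" using W openin_subset by blast
    fix w
    let ?V = "frame c (components c p w)"
    have V: "smooth_field W ?V" using smooth_field_subset[OF smooth_field_frame[OF c] W(2)] .
    have w: "?V p = w" using c W by auto
    show "g p (curvature_op X' Y' Z p) w = g p (curvature_op X' Y' Z' p) w"
      using curvature_op_skew_right[OF W(1) X(2) Y(2) Z(1) V W(3)]
        curvature_op_skew_right[OF W(1) X(2) Y(2) Z(2) V W(3)] Z(3) by (simp add: w)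
  qed
  finally show ?thesis .
qed

lemma smooth_field_extend: "p \<in> topspace M \<Longrightarrow> smooth_field (fst (chart_at p)) (extend p v)"
  by (simp add: extend_eq_frame smooth_field_frame chart_at)

lemma extend_self [simp]: "p \<in> topspace M \<Longrightarrow> extend p v p = v"
  by (simp add: extend_eq_frame)

text \<open>This frees the curvature from the chart chosen at \<open>p\<close>: it may be evaluated on any smooth fields with
  the given values, in particular on coordinate fields of one chart at all of its points.\<close>

lemma curvature_eq:
  assumes W: "openin M W" "p \<in> W"
    and X: "smooth_field W X" and Y: "smooth_field W Y" and Z: "smooth_field W Z"
  shows "curvature p (X p) (Y p) (Z p) = curvature_op X Y Z p"
proof -
  have top: "p \<in> topspace M" using W openin_subset by blast
  note c = chart_at[OF top]
  let ?U = "W \<inter> fst (chart_at p)"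
  have U: "openin M ?U" "?U \<subseteq> fst (chart_at p)" "p \<in> ?U"
    using W c chart_domain[OF c(1)] by auto
  have sm: "smooth_field ?U (extend p v)" for v
    by (rule smooth_field_subset[OF smooth_field_extend[OF top]]) blast
  have XU: "smooth_field ?U X" "smooth_field ?U Y" "smooth_field ?U Z"
    by (rule smooth_field_subset[OF X] smooth_field_subset[OF Y] smooth_field_subset[OF Z]; blast)+
  show ?thesis
    unfolding curvature_def
    by (rule curvature_op_pointwise[OF c(1) U]) (use top in \<open>auto simp: sm XU\<close>)
qed


section \<open>Symmetry of the Ricci tensor\<close>

lemma curvature_skew_left:
  assumes p: "p \<in> topspace M"
  shows "curvature p x y z = - curvature p y x z"
  unfolding curvature_def
  by (rule curvature_op_skew_left[OF chart_domain[OF chart_at(1)[OF p]]])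
    (simp_all add: p smooth_field_extend chart_at)

lemma curvature_skew_right:
  assumes p: "p \<in> topspace M"
  shows "g p (curvature p x y z) w = - g p z (curvature p x y w)"
  using curvature_op_skew_right[OF chart_domain[OF chart_at(1)[OF p]] smooth_field_extend[OF p]
      smooth_field_extend[OF p] smooth_field_extend[OF p] smooth_field_extend[OF p] chart_at(2)[OF p],
      of x y z w] p
  by (simp add: curvature_def)

text \<open>Evaluated on commuting coordinate fields, the cyclic sum consists of derivatives of torsion
  terms.\<close>

lemma first_Bianchi:
  assumes p: "p \<in> topspace M"
  shows "curvature p x y z + curvature p y z x + curvature p z x y = 0"
proof -
  let ?c = "chart_at p" and ?W = "fst (chart_at p)"
  note c = chart_at[OF p]
  have W: "openin M ?W" using chart_domain[OF c(1)] .
  note sm = smooth_field_extend[OF p]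
  have bracket: "lie_bracket (extend p u) (extend p v) q = 0" if "q \<in> ?W" for u v q
    using lie_bracket_frame[OF c(1) that] by (simp add: extend_eq_frame)
  have zero: "\<nabla> (lie_bracket (extend p u) (extend p v)) (extend p w) p = 0" for u v w
    using nabla_cong_left[OF W smooth_field_lie_bracket[OF W sm sm] sm bracket c(2)]
      nabla_zero_left[OF W sm c(2)] by metis
  have torsion: "\<nabla> (extend p u) (\<nabla> (extend p v) (extend p w)) p
      = \<nabla> (extend p u) (\<nabla> (extend p w) (extend p v)) p" for u v w
  proof (rule nabla_cong_right[OF W sm nabla_smooth[OF W sm sm] _ c(2)])
    show "\<nabla> (extend p v) (extend p w) q = \<nabla> (extend p w) (extend p v) q" if "q \<in> ?W" for q
      using nabla_torsion_free[OF W sm sm that, of v w] bracket[OF that, of v w] by simp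
  qed
  show ?thesis
    using torsion[of x y z] torsion[of y z x] torsion[of z x y]
    by (simp add: curvature_def curvature_op_def zero)
qed

text \<open>The classical octahedron argument: add the four Bianchi identities obtained by holding each of the
  four arguments fixed in the last slot; the skew symmetries cancel or identify all the terms.\<close>

lemma curvature_pair_symmetry:
  assumes p: "p \<in> topspace M"
  shows "g p (curvature p x y z) w = g p (curvature p z w x) y"
proof -
  define R where "R a b c d = g p (curvature p a b c) d" for a b c d
  have 1: "R a b c d = - R b a c d" for a b c d
    using curvature_skew_left[OF p, of a b c] by (simp add: R_def metric_minus[OF p])
  have 2: "R a b c d = - R a b d c" for a b c d
    using curvature_skew_right[OF p, of a b c d] by (simp add: R_def metric_sym[OF p, of c])
  have 3: "R a b c d + R b c a d + R c a b d = 0" for a b c d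
    using first_Bianchi[OF p, of a b c] linear_0[OF linear_metric(2)[OF p]]
    by (simp add: R_def flip: metric_add[OF p])
  have "R x y z w = R z w x y"
    using 3[of y z x w] 3[of z x w y] 3[of x w y z] 3[of w y z x]
      2[of y z x w] 2[of z x y w] 2[of x w z y] 2[of w y x z]
      1[of y x w z] 2[of x y w z] 1[of w z x y] 2[of z w y x]
    by linarith
  then show ?thesis by (simp add: R_def)
qed

lemma linear_curvature:
  assumes p: "p \<in> topspace M"
  shows "linear (\<lambda>x. curvature p x y z)" "linear (\<lambda>y. curvature p x y z)" "linear (\<lambda>z. curvature p x y z)"
proof -
  note W = chart_domain[OF chart_at(1)[OF p]] chart_at(2)[OF p] and sm = smooth_field_extend[OF p]
  show 1: "linear (\<lambda>x. curvature p x y z)" for y z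
  proof (rule linearI)
    show "curvature p (u + v) y z = curvature p u y z + curvature p v y z" for u v
      using curvature_eq[OF W smooth_field_add[OF W(1) sm sm] sm sm, of u v y z]
        curvature_op_add_left[OF W(1) sm sm sm sm W(2), of u v y z] p
      by (simp add: curvature_def)
    show "curvature p (k *\<^sub>R u) y z = k *\<^sub>R curvature p u y z" for k u
      using curvature_eq[OF W smooth_field_scaleR[OF W(1) smooth_fun_const sm] sm sm, of k u y z]
        curvature_op_scale_left[OF W(1) smooth_fun_const sm sm sm W(2), of k u y z] p
      by (simp add: curvature_def)
  qed
  have "(\<lambda>y. curvature p x y z) = (\<lambda>y. - curvature p y x z)"
    using curvature_skew_left[OF p] by blast
  then show "linear (\<lambda>y. curvature p x y z)"
    using linear_compose_neg[OF 1] by simp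
  show "linear (\<lambda>z. curvature p x y z)"
    by (rule linearI; rule metric_nondegenerate[OF p])
      (simp_all add: curvature_skew_right[OF p] metric_add[OF p] metric_scale[OF p])
qed

lemma bilinear_ricci:
  assumes p: "p \<in> topspace M"
  shows "bilinear (ricci p)"
  unfolding bilinear_def ricci_def trace_def matrix_def
  by (intro conjI allI; rule linearI)
    (simp_all add: linear_add[OF linear_curvature(2)[OF p]] linear_cmul[OF linear_curvature(2)[OF p]]
      linear_add[OF linear_curvature(3)[OF p]] linear_cmul[OF linear_curvature(3)[OF p]]
      sum.distrib sum_distrib_left)

text \<open>In an orthonormal basis the Ricci tensor is the sum of \<open>g (R(s, u) v) s\<close>, and the pair symmetry
  exchanges \<open>u\<close> and \<open>v\<close> in each summand.\<close>

lemma ricci_sym: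
  assumes p: "p \<in> topspace M"
  shows "ricci p u v = ricci p v u"
proof -
  obtain S where S: "oriented_orthonormal p S" using oriented_orthonormal_exists[OF p] .
  have ric: "ricci p u v = (\<Sum>i\<in>UNIV. g p (curvature p (S $ i) u v) (S $ i))" for u v
    unfolding ricci_def by (rule trace_orthonormal[OF p S linear_curvature(1)[OF p]])
  have "g p (curvature p s u v) s = g p (curvature p s v u) s" for s
  proof -
    have "g p (curvature p s u v) s = g p (curvature p v s s) u"
      by (rule curvature_pair_symmetry[OF p])
    also have "\<dots> = - g p (curvature p s v s) u"
      using curvature_skew_left[OF p, of v s s] by (simp add: metric_minus[OF p])
    also have "\<dots> = g p (curvature p s v u) s"
      using curvature_skew_right[OF p, of s v s u] by (simp add: metric_sym[OF p, of s])
    finally show ?thesis .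
  qed
  then show ?thesis by (simp add: ric)
qed

lemma bilinear_schouten:
  assumes p: "p \<in> topspace M"
  shows "bilinear (schouten p)"
  unfolding bilinear_def
  by (intro conjI allI; rule linearI)
    (simp_all add: schouten_def metric_add[OF p] metric_scale[OF p] algebra_simps
      bilinear_ladd[OF bilinear_ricci[OF p]] bilinear_radd[OF bilinear_ricci[OF p]]
      bilinear_lmul[OF bilinear_ricci[OF p]] bilinear_rmul[OF bilinear_ricci[OF p]])

lemma schouten_sym: "p \<in> topspace M \<Longrightarrow> schouten p u v = schouten p v u"
  by (simp add: schouten_def ricci_sym[of p u] metric_sym[of p u])

end

section \<open>Smoothness of the Schouten endomorphism\<close>

context oriented_riemannian_3manifold
begin

lemma smooth_fun_det:
  fixes F :: "'a \<Rightarrow> real^3^3"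
  assumes "openin M W" "\<And>i j. smooth_fun W (\<lambda>q. F q $ i $ j)"
  shows "smooth_fun W (\<lambda>q. det (F q))"
  unfolding det_3 using assms by (intro smooth_fun_add smooth_fun_diff smooth_fun_mult) auto

text \<open>Cramer's rule for the Gram matrix of the frame expresses the components of the endomorphism
  rationally in the values of the form and of the metric on the frame.\<close>

lemma smooth_field_endo_of_form:
  assumes c: "c \<in> A" and W: "openin M W" "W \<subseteq> fst c"
    and B: "\<And>q. q \<in> W \<Longrightarrow> bilinear (B q)"
    and sm: "\<And>i. smooth_fun W (\<lambda>q. B q (frame c v q) (frame c (axis i 1) q))"
  shows "smooth_field W (\<lambda>q. endo_of_form q (B q) (frame c v q))"
proof -
  let ?E = "\<lambda>i. frame c (axis i 1)"
  define G where "G q = (\<chi> i j. g q (?E j q) (?E i q))" for q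
  define b where "b q = (\<chi> i. B q (frame c v q) (?E i q))" for q
  define k where "k q = components c q (endo_of_form q (B q) (frame c v q))" for q
  have E: "smooth_field W (frame c v)" for v
    using smooth_field_subset[OF smooth_field_frame[OF c] W(2)] .
  have G_apply: "G q *v x = (\<chi> i. g q (frame c x q) (?E i q))" if "q \<in> W" for q x
  proof -
    have q: "q \<in> fst c" "q \<in> topspace M" using that W chart_topspace[OF c] by auto
    show ?thesis
      unfolding frame_expansion[OF c q(1), of x]
      by (simp add: G_def matrix_vector_mult_def vec_eq_iff metric_sum_left[OF q(2)]
          metric_scale[OF q(2)] mult.commute)
  qed
  have det: "det (G q) \<noteq> 0" if q: "q \<in> W" for q
  proof -
    have fc: "q \<in> fst c" and top: "q \<in> topspace M" using q W chart_topspace[OF c] by auto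
    have "x = 0" if "G q *v x = 0" for x
    proof -
      have "g q (frame c x q) (?E i q) = 0" for i
        using that by (simp add: G_apply[OF q] vec_eq_iff)
      then have "g q (frame c x q) (frame c x q) = 0"
        by (subst (2) frame_expansion[OF c fc, of x])
          (simp add: linear_sum[OF linear_metric(1)[OF top]] metric_scale[OF top])
      then have "frame c x q = 0" using metric_pos[OF top] by force
      then have "components c q (frame c x q) = 0" using linear_0[OF linear_components[OF c fc]] by simp
      then show "x = 0" using c fc by simp
    qed
    then have "inj ((*v) (G q))"
      using linear_injective_0[OF matrix_vector_mul_linear] by blast
    then have "det (matrix ((*v) (G q))) \<noteq> 0"
      using det_nz_iff_inj[OF matrix_vector_mul_linear] by blast
    then show ?thesis by (simp only: matrix_of_matrix_vector_mul not_False_eq_True)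
  qed
  have "G q *v k q = b q" if q: "q \<in> W" for q
  proof -
    have fc: "q \<in> fst c" and top: "q \<in> topspace M" using q W chart_topspace[OF c] by auto
    show ?thesis
      using c fc by (simp add: G_apply[OF q] k_def b_def metric_endo_of_form[OF top B[OF q]])
  qed
  then have "k q = (\<chi> i. det (\<chi> r s. if s = i then b q $ r else G q $ r $ s) / det (G q))"
    if "q \<in> W" for q
    using cramer[OF det[OF that], of "k q" "b q"] that by blast
  then have k: "k q $ i = det (\<chi> r s. if s = i then b q $ r else G q $ r $ s) / det (G q)"
    if "q \<in> W" for q i
    using that by simp
  have smG: "smooth_fun W (\<lambda>q. G q $ r $ s)" for r s
    unfolding G_def by (simp add: metric_smooth[OF W(1) E E])
  have smb: "smooth_fun W (\<lambda>q. b q $ r)" for r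
    unfolding b_def using sm by simp
  have entry: "smooth_fun W (\<lambda>q. (\<chi> r s. if s = i then b q $ r else G q $ r $ s) $ r $ s)" for i r s
    using smb[of r] smG[of r s] by (cases "s = i") simp_all
  have smk: "smooth_fun W (\<lambda>q. k q $ i)" for i
  proof (rule smooth_fun_cong[OF W(1)])
    show "smooth_fun W (\<lambda>q. det (\<chi> r s. if s = i then b q $ r else G q $ r $ s) / det (G q))"
      by (intro smooth_fun_divide smooth_fun_det W(1) smG entry det)
  qed (simp add: k)
  have "smooth_field W (\<lambda>q. \<Sum>i\<in>UNIV. k q $ i *\<^sub>R ?E i q)"
    by (intro smooth_field_sum smooth_field_scaleR W(1) smk E) auto
  then show ?thesis
    by (rule smooth_field_cong[OF W(1)])
      (use W(2) in \<open>auto simp: k_def field_expansion[OF c, symmetric]\<close>)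
qed

lemma smooth_fun_metric_trace:
  assumes c: "c \<in> A" and W: "openin M W" "W \<subseteq> fst c"
    and B: "\<And>q. q \<in> W \<Longrightarrow> bilinear (B q)"
    and sm: "\<And>v w. smooth_fun W (\<lambda>q. B q (frame c v q) (frame c w q))"
  shows "smooth_fun W (\<lambda>q. metric_trace q (B q))"
proof -
  let ?E = "\<lambda>i. frame c (axis i 1)"
  have "smooth_fun W (\<lambda>q. \<Sum>i\<in>UNIV. components c q (endo_of_form q (B q) (?E i q)) $ i)"
    by (intro smooth_fun_sum W(1) smooth_fun_components[OF c W] smooth_field_endo_of_form[OF c W B sm]) auto
  then show ?thesis
  proof (rule smooth_fun_cong[OF W(1)])
    fix q assume q: "q \<in> W"
    have fc: "q \<in> fst c" and top: "q \<in> topspace M" using q W chart_topspace[OF c] by auto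
    show "(\<Sum>i\<in>UNIV. components c q (endo_of_form q (B q) (?E i q)) $ i) = metric_trace q (B q)"
      unfolding metric_trace_def
      using c fc by (intro trace_conjugate[symmetric, OF linear_endo_of_form[OF top B[OF q]]
            linear_frame linear_components]) auto
  qed
qed

end

context levi_civita_3manifold
begin

text \<open>The trace is taken in the frame of \<open>c\<close>, where the curvature has smooth components because the
  connection preserves smooth fields.\<close>

lemma smooth_fun_ricci_frame:
  assumes c: "c \<in> A"
  shows "smooth_fun (fst c) (\<lambda>q. ricci q (frame c v q) (frame c w q))"
proof -
  let ?W = "fst c"
  have W: "openin M ?W" using chart_domain[OF c] .
  note E = smooth_field_frame[OF c]
  have "smooth_fun ?W (\<lambda>q. \<Sum>i\<in>UNIV.
      components c q (curvature_op (frame c (axis i 1)) (frame c v) (frame c w) q) $ i)"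
    by (intro smooth_fun_sum W smooth_fun_components[OF c W] smooth_field_curvature_op[OF W] E) auto
  then show ?thesis
  proof (rule smooth_fun_cong[OF W])
    fix q assume q: "q \<in> ?W"
    have top: "q \<in> topspace M" using q chart_topspace[OF c] by auto
    have "ricci q (frame c v q) (frame c w q) = (\<Sum>i\<in>UNIV.
        components c q (curvature q (frame c (axis i 1) q) (frame c v q) (frame c w q)) $ i)"
      unfolding ricci_def
      using c q by (intro trace_conjugate[OF linear_curvature(1)[OF top]] linear_frame linear_components) auto
    then show "(\<Sum>i\<in>UNIV. components c q (curvature_op (frame c (axis i 1)) (frame c v) (frame c w) q) $ i)
        = ricci q (frame c v q) (frame c w q)"
      by (simp add: curvature_eq[OF W q E E E])
  qed
qed

lemma smooth_field_schouten:
  assumes c: "c \<in> A"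
  shows "smooth_field (fst c) (\<lambda>q. schouten_endo q (frame c v q))"
proof -
  let ?W = "fst c"
  have W: "openin M ?W" "?W \<subseteq> fst c" using chart_domain[OF c] by auto
  have top: "q \<in> topspace M" if "q \<in> ?W" for q using that chart_topspace[OF c] by auto
  have "smooth_fun ?W scal"
    unfolding scal_def[abs_def]
    by (rule smooth_fun_metric_trace[OF c W bilinear_ricci[OF top] smooth_fun_ricci_frame[OF c]])
  then have "smooth_fun ?W (\<lambda>q. ricci q (frame c v q) (frame c w q)
      - scal q / 4 * g q (frame c v q) (frame c w q))" for v w
    by (intro smooth_fun_diff smooth_fun_ricci_frame smooth_fun_mult smooth_fun_divide smooth_fun_const
        metric_smooth smooth_field_frame W c) auto
  then have "smooth_fun ?W (\<lambda>q. schouten q (frame c v q) (frame c w q))" for v w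
    by (simp add: schouten_def)
  then show ?thesis
    unfolding schouten_endo_def by (intro smooth_field_endo_of_form[OF c W] bilinear_schouten top)
qed


section \<open>The Cotton tensor is trace-free\<close>

lemma linear_schouten_endo: "p \<in> topspace M \<Longrightarrow> linear (schouten_endo p)"
  unfolding schouten_endo_def by (intro linear_endo_of_form bilinear_schouten)

lemma schouten_endo_self_adjoint:
  assumes "p \<in> topspace M"
  shows "g p (schouten_endo p u) v = g p u (schouten_endo p v)"
  using assms schouten_sym[OF assms, of u v] metric_sym[OF assms, of u]
  by (simp add: schouten_endo_def metric_endo_of_form bilinear_schouten)

text \<open>The derivative of a self-adjoint endomorphism along any direction is self-adjoint, since the
  connection is compatible with the metric.\<close>

lemma nabla_schouten_self_adjoint:
  assumes W: "openin M W" "p \<in> W" and X: "smooth_field W X" and Y: "smooth_field W Y"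
    and Z: "smooth_field W Z"
    and SY: "smooth_field W (\<lambda>q. schouten_endo q (Y q))" and SZ: "smooth_field W (\<lambda>q. schouten_endo q (Z q))"
  shows "g p (nabla_schouten X Y p) (Z p) = g p (nabla_schouten X Z p) (Y p)"
proof -
  have top: "q \<in> topspace M" if "q \<in> W" for q using W that openin_subset by blast
  note p = top[OF W(2)]
  have "field_deriv X (\<lambda>q. g q (schouten_endo q (Y q)) (Z q)) p
      = field_deriv X (\<lambda>q. g q (Y q) (schouten_endo q (Z q))) p"
    by (rule field_deriv_cong[OF W metric_smooth[OF W(1) SY Z]]) (simp add: schouten_endo_self_adjoint top)
  then show ?thesis
    using nabla_metric[OF W(1) X SY Z W(2)] nabla_metric[OF W(1) X Y SZ W(2)]
    by (simp add: nabla_schouten_def metric_diff[OF p] schouten_endo_self_adjoint[OF p]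
        metric_sym[OF p, of _ "Y p"])
qed

text \<open>The Hodge star presupposes a bilinear form. Linearity over constants passes through the construction
  because \<open>extend p\<close> is linear in the vector throughout the chart at \<open>p\<close>.\<close>

lemma bilinear_cotton_form:
  assumes p: "p \<in> topspace M"
  shows "bilinear (cotton_form p)"
proof -
  let ?c = "chart_at p" and ?W = "fst (chart_at p)" and ?E = "extend p"
  note c = chart_at[OF p]
  have W: "openin M ?W" "p \<in> ?W" using chart_domain[OF c(1)] c(2) by auto
  have top: "q \<in> topspace M" if "q \<in> ?W" for q using chart_topspace[OF c(1) that] .
  note E = smooth_field_extend[OF p]
  have SE: "smooth_field ?W (\<lambda>q. schouten_endo q (?E v q))" for v
    using smooth_field_schouten[OF c(1)] by (simp add: extend_eq_frame)
  have E_add: "?E (u + v) q = ?E u q + ?E v q" and E_scale: "?E (k *\<^sub>R u) q = k *\<^sub>R ?E u q"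
    if "q \<in> ?W" for u v k q
    using linear_add[OF linear_frame[OF c(1) that]] linear_cmul[OF linear_frame[OF c(1) that]]
    by (simp_all add: extend_eq_frame)
  note S_lin = linear_add[OF linear_schouten_endo] linear_cmul[OF linear_schouten_endo]
  have add_left: "\<nabla> (?E (u + v)) Y p = \<nabla> (?E u) Y p + \<nabla> (?E v) Y p"
    and scale_left: "\<nabla> (?E (k *\<^sub>R u)) Y p = k *\<^sub>R \<nabla> (?E u) Y p" if Y: "smooth_field ?W Y" for u v k Y
    using nabla_cong_left[OF W(1) E Y E_add W(2)] nabla_add_left[OF W(1) E E Y W(2)]
      nabla_cong_left[OF W(1) E Y E_scale W(2)] nabla_const_left[OF W(1) E Y W(2)] by simp_all
  have add_right: "\<nabla> (?E w) (?E (u + v)) p = \<nabla> (?E w) (?E u) p + \<nabla> (?E w) (?E v) p"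
    and scale_right: "\<nabla> (?E w) (?E (k *\<^sub>R u)) p = k *\<^sub>R \<nabla> (?E w) (?E u) p" for u v k w
    using nabla_cong_right[OF W(1) E E E_add W(2)] nabla_add_right[OF W(1) E E E W(2)]
      nabla_cong_right[OF W(1) E E E_scale W(2)] nabla_const_right[OF W(1) E E W(2)] by simp_all
  have S_add: "\<nabla> (?E w) (\<lambda>q. schouten_endo q (?E (u + v) q)) p
      = \<nabla> (?E w) (\<lambda>q. schouten_endo q (?E u q)) p + \<nabla> (?E w) (\<lambda>q. schouten_endo q (?E v q)) p" for u v w
    using nabla_cong_right[OF W(1) E SE, of "u + v" "\<lambda>q. schouten_endo q (?E u q) + schouten_endo q (?E v q)" p w]
      nabla_add_right[OF W(1) E SE SE W(2)] W(2) by (simp add: E_add S_lin top)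
  have S_scale: "\<nabla> (?E w) (\<lambda>q. schouten_endo q (?E (k *\<^sub>R u) q)) p
      = k *\<^sub>R \<nabla> (?E w) (\<lambda>q. schouten_endo q (?E u q)) p" for u k w
    using nabla_cong_right[OF W(1) E SE, of "k *\<^sub>R u" "\<lambda>q. k *\<^sub>R schouten_endo q (?E u q)" p w]
      nabla_const_right[OF W(1) E SE W(2)] W(2) by (simp add: E_scale S_lin top)
  show ?thesis
    unfolding bilinear_def
    by (intro conjI allI; rule linearI)
      (simp_all add: cotton_form_def cotton_form_op_def nabla_schouten_def add_left[OF E] add_left[OF SE]
        scale_left[OF E] scale_left[OF SE] add_right scale_right S_add S_scale S_lin p algebra_simps)
qed

text \<open>In an oriented orthonormal frame the trace is the cyclic sum of
  \<open>g ((\<nabla>\<^sub>i S) e\<^sub>j - (\<nabla>\<^sub>j S) e\<^sub>i) e\<^sub>k\<close>, in which every term occurs twice with opposite signs because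
  each \<open>\<nabla>\<^sub>i S\<close> is self-adjoint.\<close>

lemma metric_trace_cotton_tensor:
  assumes p: "p \<in> topspace M"
  shows "metric_trace p (cotton_tensor p) = 0"
proof -
  let ?\<omega> = "cotton_form p" and ?N = "\<lambda>x y. nabla_schouten (extend p x) (extend p y) p"
  note c = chart_at[OF p]
  have alt: "?\<omega> v w = - ?\<omega> w v" for v w by (simp add: cotton_form_def cotton_form_op_def)
  note star = hodge_star[OF p bilinear_cotton_form[OF p] alt]
  obtain S where S: "oriented_orthonormal p S" using oriented_orthonormal_exists[OF p] .
  have "endo_of_form p (cotton_tensor p) = hodge_star p ?\<omega>"
    by (rule ext) (simp add: endo_of_form_def cotton_tensor_def sharp_eqI[OF p])
  then have tr: "metric_trace p (cotton_tensor p) = g p (?\<omega> (S $ 2) (S $ 3)) (S $ 1)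
      + g p (?\<omega> (S $ 3) (S $ 1)) (S $ 2) + g p (?\<omega> (S $ 1) (S $ 2)) (S $ 3)"
    using star S by (simp add: metric_trace_def trace_orthonormal[OF p S] sum_3)
  have "smooth_field (fst (chart_at p)) (\<lambda>q. schouten_endo q (extend p v q))" for v
    using smooth_field_schouten[OF c(1)] by (simp add: extend_eq_frame)
  then have sym: "g p (?N x y) z = g p (?N x z) y" for x y z
    using nabla_schouten_self_adjoint[OF chart_domain[OF c(1)] c(2) smooth_field_extend[OF p]
        smooth_field_extend[OF p] smooth_field_extend[OF p], of y z x] p by simp
  show ?thesis
    unfolding tr cotton_form_def cotton_form_op_def metric_diff[OF p]
    using sym[of "S $ 1" "S $ 2" "S $ 3"] sym[of "S $ 2" "S $ 3" "S $ 1"] sym[of "S $ 3" "S $ 1" "S $ 2"]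
    by simp
qed

end

theorem proposition13:
  fixes M :: "'a topology" and A :: "'a chart set"
    and g :: "'a \<Rightarrow> real^3 \<Rightarrow> real^3 \<Rightarrow> real"
    and nabla :: "('a \<Rightarrow> real^3) \<Rightarrow> ('a \<Rightarrow> real^3) \<Rightarrow> 'a \<Rightarrow> real^3"
  assumes "levi_civita_3manifold M A g nabla"
  shows "\<forall>p\<in>topspace M. oriented_riemannian_3manifold.metric_trace g p
           (levi_civita_3manifold.cotton_tensor M A g nabla p) = 0"
  using levi_civita_3manifold.metric_trace_cotton_tensor[OF assms] by blast

end
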